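(* For any $r,d\in\mathbb{N}$ and $\varepsilon\in(0,1)$ we have $$ n(\varepsilon,d,r)\;\le\;\min_{s=1,2,\dots,r}\ \max\left\{(s+1)^d,\ \left\lceil\left(\frac{\pi}{2}\left(\frac{e}{6\sqrt{3}}\right)^s\frac{d}{\varepsilon}\right)^{1/s}\right\rceil^{d}\right\}, $$ where $e$ denotes Euler's number.
   Context: Here $\mathbb{N}=\{1,2,\dots\}$, $\mathbb{N}_0=\{0,1,2,\dots\}$, and $|\beta|_1=\beta_1+\dots+\beta_d$ for $\beta\in\mathbb{N}_0^d$; $D^\beta$ is the partial derivative of order $\beta$. Let $\mathcal{C}^r_d$ be the class of all $r$-times continuously differentiable functions $f:[0,1]^d\to\mathbb{R}$ with $\sup_{x\in[0,1]^d}|(D^\beta f)(x)|\le 1$ for all $\beta\in\mathbb{N}_0^d$ with $|\beta|_1\le r$. The problem is to approximate $S_d(f)=\int_{[0,1]^d} f(x)\,dx$ for $f\in\mathcal{C}^r_d$. An algorithm using $n$ function values is a map $A_n:\mathcal{C}^r_d\to\mathbb{R}$ of the form $A_n(f)=\phi_n(f(x_1),\dots,f(x_n))$, where $\phi_n:\mathbb{R}^n\to\mathbb{R}$ is an arbitrary (possibly nonlinear) map and the sample points $x_i\in[0,1]^d$ may be chosen adaptively, i.e., $x_i$ may depend on the already computed values $f(x_1),\dots,f(x_{i-1})$ (for $n=0$, $A_0$ is a constant). Its worst case error is $e(A_n)=\sup_{f\in\mathcal{C}^r_d}|S_d(f)-A_n(f)|$, and the $n$th minimal error is $e_n(\mathcal{C}^r_d)=\inf_{A_n}e(A_n)$,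 the infimum being over all such algorithms. Define $$n(\varepsilon,d,r)=\min\{n\in\mathbb{N}_0:\ e_n(\mathcal{C}^r_d)\le\varepsilon\}.$$ *)

theory Defs
  imports "HOL-Analysis.Analysis"
begin

abbreviation unit_cube :: "(real ^ 'd::finite) set" where
  "unit_cube \<equiv> cbox 0 1"

text \<open>
  Functions on the unit cube are represented by total functions whose values outside the cube
  are irrelevant. Derivatives are taken within the cube, so on the boundary they are one-sided.
\<close>

definition has_partials :: "(real ^ 'd::finite \<Rightarrow> real) \<Rightarrow> bool" where
  "has_partials f \<longleftrightarrow> (\<forall>i. \<forall>x\<in>unit_cube.
     (\<lambda>t. f (x + t *\<^sub>R axis i 1)) differentiable
       (at 0 within {t. x + t *\<^sub>R axis i 1 \<in> unit_cube}))"

definition partial :: "'d::finite \<Rightarrow> (real ^ 'd \<Rightarrow> real) \<Rightarrow> (real ^ 'd \<Rightarrow> real)" where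
  "partial i f = (\<lambda>x. vector_derivative (\<lambda>t. f (x + t *\<^sub>R axis i 1))
     (at 0 within {t. x + t *\<^sub>R axis i 1 \<in> unit_cube}))"

primrec cont_diff :: "nat \<Rightarrow> (real ^ 'd::finite \<Rightarrow> real) \<Rightarrow> bool" where
  "cont_diff 0 f \<longleftrightarrow> continuous_on unit_cube f"
| "cont_diff (Suc r) f \<longleftrightarrow>
     continuous_on unit_cube f \<and> has_partials f \<and> (\<forall>i. cont_diff r (partial i f))"

text \<open>
  The derivative of order \<open>\<beta>\<close> applies \<open>partial i\<close> exactly \<open>\<beta> $ i\<close> times for every \<open>i\<close>. The index
  type carries no order, so some order of differentiation is chosen; by Schwarz's theorem the
  choice does not matter on the cube when \<open>f\<close> is \<open>|\<beta>|\<^sub>1\<close> times continuously differentiable.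
\<close>

definition Dmulti :: "nat ^ 'd::finite \<Rightarrow> (real ^ 'd \<Rightarrow> real) \<Rightarrow> (real ^ 'd \<Rightarrow> real)" where
  "Dmulti \<beta> f = foldr partial (SOME is. \<forall>i. count_list is i = \<beta> $ i) f"

definition smooth_class :: "nat \<Rightarrow> (real ^ 'd::finite \<Rightarrow> real) set" where
  "smooth_class r = {f. cont_diff r f \<and>
     (\<forall>\<beta>. (\<Sum>i\<in>UNIV. \<beta> $ i) \<le> r \<longrightarrow> (\<forall>x\<in>unit_cube. \<bar>Dmulti \<beta> f x\<bar> \<le> 1))}"

text \<open>
  An adaptive sampling strategy maps the list of the values computed so far to the next sample
  point; \<open>samples node n f\<close> is the list of the first \<open>n\<close> computed values.
\<close>

primrec samples ::
  "(real list \<Rightarrow> real ^ 'd::finite) \<Rightarrow> nat \<Rightarrow> (real ^ 'd \<Rightarrow> real) \<Rightarrow> real list" where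
  "samples node 0 f = []"
| "samples node (Suc n) f = samples node n f @ [f (node (samples node n f))]"

definition algorithms :: "nat \<Rightarrow> ((real ^ 'd::finite \<Rightarrow> real) \<Rightarrow> real) set" where
  "algorithms n = {A. \<exists>node \<phi>.
     (\<forall>ys. length ys < n \<longrightarrow> node ys \<in> unit_cube) \<and> A = (\<lambda>f. \<phi> (samples node n f))}"

definition worst_case_error ::
  "nat \<Rightarrow> ((real ^ 'd::finite \<Rightarrow> real) \<Rightarrow> real) \<Rightarrow> ennreal" where
  "worst_case_error r A = (SUP f\<in>smooth_class r. ennreal \<bar>integral unit_cube f - A f\<bar>)"

definition minimal_error :: "'d::finite itself \<Rightarrow> nat \<Rightarrow> nat \<Rightarrow> ennreal" where
  "minimal_error _ r n =
     (INF A \<in> (algorithms n :: ((real ^ 'd \<Rightarrow> real) \<Rightarrow> real) set). worst_case_error r A)"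

text \<open>
  The minimum is taken in \<open>enat\<close>, where the infimum of a nonempty set is attained and the
  infimum of the empty set is \<open>\<infinity>\<close>. A finite upper bound thus includes the existence of a
  suitable \<open>n\<close>.
\<close>

definition complexity :: "real \<Rightarrow> 'd::finite itself \<Rightarrow> nat \<Rightarrow> enat" where
  "complexity \<epsilon> d r = Inf (enat ` {n. minimal_error d r n \<le> ennreal \<epsilon>})"

end

theory Submission
  imports Defs
begin

text \<open>
  The bound is attained by product rules. Suppose that a rule on \<open>[0, 1]\<close> with \<open>m\<close> nodes and nonnegative
  weights has error at most \<open>K / m ^ s\<close> whenever the \<open>s\<close>-th derivative is bounded by 1. Replace the
  integrations over the \<open>d\<close> coordinates by the rule one at a time. Each replacement costs at most
  \<open>K / m ^ s\<close>, because the weights are nonnegative with sum 1 and so preserve the bounds for the pure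
  derivatives of order \<open>s\<close>. Hence the product rule, with \<open>m ^ d\<close> nodes, has error at most \<open>d K / m ^ s\<close>,
  and \<open>complexity_le_of_rule\<close> follows. The maximum in the theorem is \<open>m ^ d\<close> for the least \<open>m \<ge> s + 1\<close>
  that makes this error at most \<open>\<epsilon>\<close>, with \<open>K = \<pi>/2 (e / (6 \<surd>3)) ^ s\<close>. What remains is
  \<open>has_rule_rule_const\<close>: this \<open>K\<close> is admissible on \<open>[0, 1]\<close> for all \<open>s \<ge> 1\<close> and \<open>m \<ge> s + 1\<close>.

  Rules can be concatenated without loss (\<open>has_rule_add\<close>), so only \<open>s + 1 \<le> m \<le> 2 s + 1\<close> has to be
  treated, and for \<open>s \<le> 2\<close> the midpoint rule suffices. For \<open>s \<ge> 3\<close> take the Gauss-Legendre rule, which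
  is positive and exact for degrees below \<open>2 m\<close>. By Weierstrass' theorem the error has to be bounded for
  polynomials only (\<open>quadrature_error_from_polys\<close>). Expand such a polynomial on \<open>[-1, 1]\<close> as a sum of
  \<open>c\<^sub>k T\<^sub>k\<close> with Chebyshev polynomials \<open>T\<^sub>k\<close>. The terms with \<open>k < 2 m\<close> are integrated exactly, and for the
  others the error is about 2 at most, as \<open>T\<^sub>k\<close> is bounded by 1. The \<open>s\<close>-th derivatives of the \<open>T\<^sub>k\<close> are
  orthogonal for the weight \<open>(1 - x\<^sup>2) powr (s - 1/2)\<close>, with squared norm \<open>\<pi>/2\<close> times the product of
  \<open>k\<^sup>2 - j\<^sup>2\<close> over \<open>j < s\<close>. A bound for the \<open>s\<close>-th derivative therefore bounds the sum of the \<open>c\<^sub>k\<^sup>2\<close>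
  multiplied by these products (\<open>cheb_coeffs_weighted_bound\<close>), and the Cauchy-Schwarz inequality bounds the
  error by a telescoping tail sum (\<open>Gauss_poly_error\<close>). At \<open>m = s + 1\<close> the product for \<open>k = 2 m\<close> grows
  like \<open>(3 s)! / s!\<close> up to powers of \<open>s\<close>, and Stirling's formula turns this into the number \<open>e / (6 \<surd>3)\<close>; the explicit
  inequality is proved by induction on \<open>s\<close> (\<open>gauss_const_diagonal_bound\<close>).
\<close>

section \<open>Quadrature rules on the unit interval and their concatenation\<close>

definition deriv_bound :: "nat \<Rightarrow> real \<Rightarrow> real \<Rightarrow> real \<Rightarrow> (real \<Rightarrow> real) \<Rightarrow> bool" where
  "deriv_bound s M a b f \<longleftrightarrow> (\<exists>g. g 0 = f \<and>
     (\<forall>k<s. \<forall>t\<in>{a..b}. (g k has_real_derivative g (Suc k) t) (at t within {a..b})) \<and>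
     continuous_on {a..b} (g s) \<and> (\<forall>t\<in>{a..b}. \<bar>g s t\<bar> \<le> M))"

lemma deriv_bound_continuous:
  assumes "deriv_bound s M a b f"
  shows "continuous_on {a..b} f"
proof -
  obtain g where g: "g 0 = f"
    "\<forall>k<s. \<forall>t\<in>{a..b}. (g k has_real_derivative g (Suc k) t) (at t within {a..b})"
    "continuous_on {a..b} (g s)"
    using assms unfolding deriv_bound_def by blast
  show ?thesis
  proof (cases s)
    case 0
    then show ?thesis using g by simp
  next
    case (Suc s')
    then show ?thesis
      using g(1,2) by (metis DERIV_continuous continuous_on_eq_continuous_within zero_less_Suc)
  qed
qed

lemma deriv_bound_const_0:
  "s \<ge> 1 \<Longrightarrow> deriv_bound s 0 a b (\<lambda>_. c)"
  unfolding deriv_bound_def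
  by (rule exI[of _ "\<lambda>k t. if k = 0 then c else 0"]) auto

lemma deriv_bound_affine:
  assumes f: "deriv_bound s M (m * a + c) (m * b + c) f" and m: "m > 0"
  shows "deriv_bound s (M * m ^ s) a b (\<lambda>t. f (m * t + c))"
proof -
  let ?S = "{m * a + c..m * b + c}"
  obtain g where g: "g 0 = f"
    "\<And>k t. k < s \<Longrightarrow> t \<in> ?S \<Longrightarrow> (g k has_real_derivative g (Suc k) t) (at t within ?S)"
    "continuous_on ?S (g s)" "\<And>t. t \<in> ?S \<Longrightarrow> \<bar>g s t\<bar> \<le> M"
    using f unfolding deriv_bound_def by blast
  have im: "(\<lambda>t. m * t + c) ` {a..b} \<subseteq> ?S"
    using m by auto
  let ?h = "\<lambda>k t. m ^ k * g k (m * t + c)"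
  have "(?h k has_real_derivative ?h (Suc k) t) (at t within {a..b})"
    if "k < s" "t \<in> {a..b}" for k t
  proof -
    have d: "((\<lambda>t. m * t + c) has_real_derivative m) (at t within {a..b})"
      by (auto intro!: derivative_eq_intros)
    have "(g k has_real_derivative g (Suc k) (m * t + c)) (at (m * t + c) within (\<lambda>t. m * t + c) ` {a..b})"
      using DERIV_subset[OF g(2)[OF that(1)] im] im that(2) by blast
    from DERIV_image_chain[OF this d]
    have "((\<lambda>t. g k (m * t + c)) has_real_derivative g (Suc k) (m * t + c) * m) (at t within {a..b})"
      by (simp add: o_def)
    from DERIV_cmult[OF this, of "m ^ k"] show ?thesis
      by (simp add: mult_ac)
  qed
  moreover have "continuous_on {a..b} (?h s)"
    by (intro continuous_intros continuous_on_compose2[OF g(3)] im)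
  moreover have "\<bar>?h s t\<bar> \<le> M * m ^ s" if "t \<in> {a..b}" for t
  proof -
    have "\<bar>g s (m * t + c)\<bar> \<le> M"
      using im that by (intro g(4)) blast
    then show ?thesis
      using m by (simp add: abs_mult mult.commute)
  qed
  ultimately show ?thesis
    unfolding deriv_bound_def using g(1) by (intro exI[of _ ?h]) auto
qed

lemma deriv_bound_subset:
  assumes "deriv_bound s M a b f" "a \<le> a'" "b' \<le> b"
  shows "deriv_bound s M a' b' f"
proof -
  have sub: "{a'..b'} \<subseteq> {a..b}" using assms by auto
  obtain g where g: "g 0 = f"
    "\<And>k t. k < s \<Longrightarrow> t \<in> {a..b} \<Longrightarrow> (g k has_real_derivative g (Suc k) t) (at t within {a..b})"
    "continuous_on {a..b} (g s)" "\<And>t. t \<in> {a..b} \<Longrightarrow> \<bar>g s t\<bar> \<le> M"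
    using assms(1) unfolding deriv_bound_def by blast
  show ?thesis
    unfolding deriv_bound_def
    using g sub continuous_on_subset[OF g(3) sub]
    by (intro exI[of _ g]) (auto intro: DERIV_subset[OF _ sub])
qed

lemma integral_affine:
  fixes f :: "real \<Rightarrow> real"
  assumes f: "continuous_on {m * a + c..m * b + c} f" and m: "m > 0"
  shows "integral {m * a + c..m * b + c} f = m * integral {a..b} (\<lambda>t. f (m * t + c))"
proof -
  have "(f has_integral integral {m * a + c..m * b + c} f) (cbox (m * a + c) (m * b + c))"
    using integrable_continuous_real[OF f] by (simp add: integrable_integral)
  from has_integral_affinity'[OF this m, of c]
  have "((\<lambda>t. f (m * t + c)) has_integral integral {m * a + c..m * b + c} f / m) {a..b}"
    using m by (simp add: divide_inverse_commute mult.assoc[symmetric] del: mult.assoc)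
  then show ?thesis
    using m by (simp add: integral_unique)
qed

text \<open>
  A rule with \<open>n\<close> nodes and nonnegative weights whose error is at most \<open>K M / n ^ s\<close> on every function
  with \<open>s\<close>-th derivative bounded by \<open>M\<close>. Keeping \<open>M\<close> free makes the notion invariant under
  rescaling, and for \<open>s \<ge> 1\<close> the case \<open>M = 0\<close> says that constants are integrated exactly, so that
  the weights sum to 1.
\<close>
definition has_rule :: "nat \<Rightarrow> real \<Rightarrow> nat \<Rightarrow> bool" where
  "has_rule s K n \<longleftrightarrow> (\<exists>x w. (\<forall>i<n. x i \<in> {0..1} \<and> 0 \<le> w i) \<and>
     (\<forall>M f. deriv_bound s M 0 1 f \<longrightarrow>
        \<bar>integral {0..1} f - (\<Sum>i<n. w i * f (x i))\<bar> \<le> K * M / real n ^ s))"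

text \<open>
  Cut the interval in the proportion \<open>a : b\<close> and put a scaled copy of each rule on its piece. A piece of
  length \<open>h = a / (a + b)\<close> turns the derivative bound \<open>M\<close> into \<open>M h ^ s\<close>, and \<open>h / a = 1 / (a + b)\<close>, so
  its rule has error at most \<open>h K M / (a + b) ^ s\<close>. The factors \<open>h\<close> of the two pieces add up to 1:
  the constant \<open>K\<close> does not deteriorate.
\<close>
lemma has_rule_add:
  assumes "has_rule s K a" "has_rule s K b" and pos: "a > 0" "b > 0"
  shows "has_rule s K (a + b)"
proof -
  obtain x w where x: "\<And>i. i < a \<Longrightarrow> x i \<in> {0..1} \<and> 0 \<le> w i"
    and xe: "\<And>M f. deriv_bound s M 0 1 f \<Longrightarrow>
        \<bar>integral {0..1} f - (\<Sum>i<a. w i * f (x i))\<bar> \<le> K * M / real a ^ s"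
    using assms(1) unfolding has_rule_def by blast
  obtain y v where y: "\<And>i. i < b \<Longrightarrow> y i \<in> {0..1} \<and> 0 \<le> v i"
    and ye: "\<And>M f. deriv_bound s M 0 1 f \<Longrightarrow>
        \<bar>integral {0..1} f - (\<Sum>i<b. v i * f (y i))\<bar> \<le> K * M / real b ^ s"
    using assms(2) unfolding has_rule_def by blast
  define \<alpha> where "\<alpha> = real a / real (a + b)"
  define \<beta> where "\<beta> = real b / real (a + b)"
  have ab: "\<alpha> > 0" "\<beta> > 0" "\<alpha> + \<beta> = 1"
    using pos by (auto simp: \<alpha>_def \<beta>_def divide_simps)
  define z where "z = (\<lambda>i. if i < a then \<alpha> * x i else \<beta> * y (i - a) + \<alpha>)"
  define u where "u = (\<lambda>i. if i < a then \<alpha> * w i else \<beta> * v (i - a))"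
  have "z i \<in> {0..1} \<and> 0 \<le> u i" if "i < a + b" for i
  proof (cases "i < a")
    case True
    then show ?thesis
      using x[OF True] ab mult_mono[of \<alpha> 1 "x i" 1] by (auto simp: z_def u_def)
  next
    case False
    then have "i - a < b" using that by auto
    from y[OF this] have y': "0 \<le> y (i - a)" "y (i - a) \<le> 1" "0 \<le> v (i - a)" by auto
    have "\<beta> * y (i - a) \<le> \<beta> * 1" using ab y' by (intro mult_left_mono) auto
    moreover have "0 \<le> \<beta> * y (i - a)" using ab y' by simp
    ultimately have "0 \<le> \<beta> * y (i - a) + \<alpha>" "\<beta> * y (i - a) + \<alpha> \<le> 1"
      using ab by linarith+
    then show ?thesis using False ab y' by (simp add: z_def u_def)
  qed
  moreover have "\<bar>integral {0..1} f - (\<Sum>i<a + b. u i * f (z i))\<bar> \<le> K * M / real (a + b) ^ s"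
    if f: "deriv_bound s M 0 1 f" for M f
  proof -
    let ?f1 = "\<lambda>t. f (\<alpha> * t + 0)" and ?f2 = "\<lambda>t. f (\<beta> * t + \<alpha>)"
    have d1: "deriv_bound s (M * \<alpha> ^ s) 0 1 ?f1"
      using ab by (intro deriv_bound_affine deriv_bound_subset[OF f]) auto
    have d2: "deriv_bound s (M * \<beta> ^ s) 0 1 ?f2"
      using ab by (intro deriv_bound_affine deriv_bound_subset[OF f]) auto
    have c: "continuous_on {0..1} f" by (rule deriv_bound_continuous[OF f])
    have "integral {0..1} f = integral {0..\<alpha>} f + integral {\<alpha>..1} f"
      using ab integrable_continuous_real[OF c]
      by (simp add: Henstock_Kurzweil_Integration.integral_combine)
    also have "integral {0..\<alpha>} f = \<alpha> * integral {0..1} ?f1"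
      using ab integral_affine[of \<alpha> 0 0 1 f] continuous_on_subset[OF c] by auto
    also have "integral {\<alpha>..1} f = \<beta> * integral {0..1} ?f2"
      using ab integral_affine[of \<beta> 0 \<alpha> 1 f] continuous_on_subset[OF c] by (auto simp: add.commute)
    finally have I: "integral {0..1} f = \<alpha> * integral {0..1} ?f1 + \<beta> * integral {0..1} ?f2" .
    have "(\<Sum>i<a + b. u i * f (z i)) = (\<Sum>i<a. u i * f (z i)) + (\<Sum>i<b. u (a + i) * f (z (a + i)))"
      by (induction b) (auto simp: add.assoc)
    also have "(\<Sum>i<a. u i * f (z i)) = \<alpha> * (\<Sum>i<a. w i * ?f1 (x i))"
      by (simp add: u_def z_def sum_distrib_left mult.assoc)
    also have "(\<Sum>i<b. u (a + i) * f (z (a + i))) = \<beta> * (\<Sum>i<b. v i * ?f2 (y i))"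
      by (simp add: u_def z_def sum_distrib_left mult.assoc)
    finally have Q: "(\<Sum>i<a + b. u i * f (z i)) =
      \<alpha> * (\<Sum>i<a. w i * ?f1 (x i)) + \<beta> * (\<Sum>i<b. v i * ?f2 (y i))" .
    let ?D1 = "integral {0..1} ?f1 - (\<Sum>i<a. w i * ?f1 (x i))"
    let ?D2 = "integral {0..1} ?f2 - (\<Sum>i<b. v i * ?f2 (y i))"
    have e1: "\<bar>?D1\<bar> \<le> K * M / real (a + b) ^ s"
      using xe[OF d1] pos by (simp add: \<alpha>_def power_divide)
    have e2: "\<bar>?D2\<bar> \<le> K * M / real (a + b) ^ s"
      using ye[OF d2] pos by (simp add: \<beta>_def power_divide)
    have "\<bar>integral {0..1} f - (\<Sum>i<a + b. u i * f (z i))\<bar> = \<bar>\<alpha> * ?D1 + \<beta> * ?D2\<bar>"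
      unfolding I Q by (simp add: algebra_simps)
    also have "\<dots> \<le> \<alpha> * \<bar>?D1\<bar> + \<beta> * \<bar>?D2\<bar>"
      using ab by (simp add: abs_mult order.trans[OF abs_triangle_ineq])
    also have "\<dots> \<le> \<alpha> * (K * M / real (a + b) ^ s) + \<beta> * (K * M / real (a + b) ^ s)"
      using ab e1 e2 by (intro add_mono mult_left_mono) auto
    also have "\<dots> = K * M / real (a + b) ^ s"
      using ab(3) by (metis distrib_right mult_1)
    finally show ?thesis .
  qed
  ultimately show ?thesis
    unfolding has_rule_def by blast
qed

text \<open>
  Every \<open>n \<ge> l\<close> is a sum of numbers in \<open>{l..<2 * l}\<close>. This confines the analysis of Gauss rules to
  node numbers comparable with the smoothness \<open>s\<close>, where the tail sums below lose only a bounded factor.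
\<close>
lemma has_rule_all_from_range:
  assumes base: "\<And>n. l \<le> n \<Longrightarrow> n < 2 * l \<Longrightarrow> has_rule s K n" and "l > 0" "l \<le> n"
  shows "has_rule s K n"
  using \<open>l \<le> n\<close>
proof (induction n rule: less_induct)
  case (less n)
  show ?case
  proof (cases "n < 2 * l")
    case True
    then show ?thesis using less base by blast
  next
    case False
    have "has_rule s K (l + (n - l))"
      using False \<open>l > 0\<close> less base by (intro has_rule_add) auto
    then show ?thesis using False by simp
  qed
qed

section \<open>The midpoint rule\<close>

lemma midpoint_error_first_order:
  assumes f: "deriv_bound 1 M 0 1 f"
  shows "\<bar>integral {0..1} f - f (1/2)\<bar> \<le> M / 4"
proof -
  obtain g where "g 0 = f"
    "\<forall>k<1. \<forall>t\<in>{0..1}. (g k has_real_derivative g (Suc k) t) (at t within {0..1})"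
    "\<forall>t\<in>{0..1}. \<bar>g 1 t\<bar> \<le> M"
    using f unfolding deriv_bound_def by blast
  then have g: "g 0 = f"
    "\<And>t. t \<in> {0..1} \<Longrightarrow> (g 0 has_real_derivative g 1 t) (at t within {0..1})"
    "\<And>t. t \<in> {0..1} \<Longrightarrow> \<bar>g 1 t\<bar> \<le> M"
    by auto
  have c: "continuous_on {0..1} f" by (rule deriv_bound_continuous[OF f])
  have lip: "\<bar>f t - f (1/2)\<bar> \<le> M * \<bar>t - 1/2\<bar>" if "t \<in> {0..1}" for t
    using field_differentiable_bound[of "{0..1}" f "g 1" M t "1/2"] g that by auto
  have a1: "((\<lambda>t. M * (1/2 - t)) has_integral (M * (1/2 * (1/2) - (1/2)^2/2) - M * (1/2 * 0 - 0^2/2))) {0..1/2::real}"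
    by (rule fundamental_theorem_of_calculus)
       (auto intro!: derivative_eq_intros simp: has_real_derivative_iff_has_vector_derivative[symmetric])
  have a2: "((\<lambda>t. M * (t - 1/2)) has_integral (M * (1^2/2 - 1/2 * 1) - M * ((1/2)^2/2 - 1/2 * (1/2)))) {1/2..1::real}"
    by (rule fundamental_theorem_of_calculus)
       (auto intro!: derivative_eq_intros simp: has_real_derivative_iff_has_vector_derivative[symmetric])
  have b1: "((\<lambda>t. M * \<bar>t - 1/2\<bar>) has_integral M/8) {0..1/2::real}"
    using a1 by (rule has_integral_eq_rhs[OF has_integral_eq[rotated]]) (auto simp: power2_eq_square)
  have b2: "((\<lambda>t. M * \<bar>t - 1/2\<bar>) has_integral M/8) {1/2..1::real}"
    using a2 by (rule has_integral_eq_rhs[OF has_integral_eq[rotated]]) (auto simp: power2_eq_square)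
  have I: "((\<lambda>t. M * \<bar>t - 1/2\<bar>) has_integral M/4) {0..1::real}"
    using has_integral_combine[OF _ _ b1 b2] by simp
  have F: "((\<lambda>t. f t - f (1/2)) has_integral (integral {0..1} f - f (1/2))) {0..1}"
    using has_integral_diff[OF integrable_integral[OF integrable_continuous_real[OF c]]
        has_integral_const_real[of "f (1/2)" 0 1]] by simp
  show ?thesis
    using integral_norm_bound_integral[of "\<lambda>t. f t - f (1/2)" "{0..1}" "\<lambda>t. M * \<bar>t - 1/2\<bar>"]
lip F I integral_unique[OF F] integral_unique[OF I]
    by (auto simp: has_integral_integrable simp del: integral_mult_right)
qed

text \<open>
  The tangent at the midpoint has the midpoint value as its integral. Two applications of the mean value
  theorem bound the distance of \<open>f\<close> from it by \<open>M (t - 1/2)\<^sup>2\<close>, whose integral is \<open>M / 12\<close>.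
\<close>
lemma midpoint_error_second_order:
  assumes f: "deriv_bound 2 M 0 1 f"
  shows "\<bar>integral {0..1} f - f (1/2)\<bar> \<le> M / 12"
proof -
  obtain g where g: "g 0 = f"
    "\<And>k t. k < 2 \<Longrightarrow> t \<in> {0..1} \<Longrightarrow> (g k has_real_derivative g (Suc k) t) (at t within {0..1})"
    "\<And>t. t \<in> {0..1} \<Longrightarrow> \<bar>g 2 t\<bar> \<le> M"
    using f unfolding deriv_bound_def by auto
  have c: "continuous_on {0..1} f" by (rule deriv_bound_continuous[OF f])
  define p where "p = g 1 (1/2)"
  have lip: "\<bar>f t - f (1/2) - p * (t - 1/2)\<bar> \<le> M * (t - 1/2)\<^sup>2" if t: "t \<in> {0..1}" for t
  proof -
    let ?S = "closed_segment (1/2) t"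
    have sub: "?S \<subseteq> {0..1}"
      using t by (intro closed_segment_subset) auto
    have "\<bar>g 1 u - p\<bar> \<le> M * \<bar>t - 1/2\<bar>" if u: "u \<in> ?S" for u
    proof -
      have "\<bar>g 1 u - p\<bar> \<le> M * \<bar>u - 1/2\<bar>"
        using field_differentiable_bound[of "{0..1}" "g 1" "g 2" M u "1/2"] g(2)[of 1] g(3) sub u
        by (auto simp: p_def numeral_2_eq_2)
      also have "\<dots> \<le> M * \<bar>t - 1/2\<bar>"
        using u g(3)[OF t] by (intro mult_left_mono) (auto simp: closed_segment_eq_real_ivl split: if_splits)
      finally show ?thesis .
    qed
    moreover have "((\<lambda>u. f u - p * u) has_real_derivative (g 1 u - p)) (at u within ?S)" if "u \<in> ?S" for u
      using DERIV_subset[OF g(2)[of 0 u] sub] g(1) sub that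
      by (auto intro!: derivative_eq_intros)
    ultimately have "norm ((f t - p * t) - (f (1/2) - p * (1/2))) \<le> M * \<bar>t - 1/2\<bar> * norm (t - 1/2)"
      by (intro field_differentiable_bound[of ?S _ "\<lambda>u. g 1 u - p"]) auto
    then show ?thesis
      by (simp add: algebra_simps power2_eq_square abs_mult_self_eq flip: abs_mult)
  qed
  have I: "((\<lambda>t. M * (t - 1/2)\<^sup>2) has_integral (M/3 * (1 - 1/2)^3 - M/3 * (0 - 1/2)^3)) {0..1::real}"
    by (rule fundamental_theorem_of_calculus)
       (auto intro!: derivative_eq_intros simp: has_real_derivative_iff_has_vector_derivative[symmetric])
  have L: "((\<lambda>t. p * (t - 1/2)) has_integral (p * (1^2/2 - 1/2 * 1) - p * (0^2/2 - 1/2 * 0))) {0..1::real}"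
    by (rule fundamental_theorem_of_calculus)
       (auto intro!: derivative_eq_intros simp: has_real_derivative_iff_has_vector_derivative[symmetric])
  have F: "((\<lambda>t. f t - f (1/2) - p * (t - 1/2)) has_integral (integral {0..1} f - f (1/2))) {0..1}"
    using has_integral_diff[OF has_integral_diff[OF integrable_integral[OF integrable_continuous_real[OF c]]
        has_integral_const_real[of "f (1/2)" 0 1]] L] by simp
  show ?thesis
    using integral_norm_bound_integral[of "\<lambda>t. f t - f (1/2) - p * (t - 1/2)" "{0..1}" "\<lambda>t. M * (t - 1/2)\<^sup>2"]
      lip F I integral_unique[OF F] integral_unique[OF I]
    by (auto simp: has_integral_integrable power3_eq_cube simp del: integral_mult_right)
qed

section \<open>Gauss-Legendre quadrature\<close>

lemma has_integral_derivative:
  fixes F :: "real \<Rightarrow> real"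
  assumes "a \<le> b" "\<And>x. (F has_real_derivative f x) (at x)"
  shows "(f has_integral (F b - F a)) {a..b}"
proof (rule fundamental_theorem_of_calculus[OF assms(1)])
  fix x
  show "(F has_vector_derivative f x) (at x within {a..b})"
    using has_field_derivative_at_within[OF assms(2)]
    by (simp only: has_real_derivative_iff_has_vector_derivative)
qed

lemma integrable_poly [simp]:
  fixes p :: "real poly"
  shows "poly p integrable_on {a..b}"
  by (intro integrable_continuous_real continuous_intros)

definition poly_int :: "real poly \<Rightarrow> real" where
  "poly_int p = integral {-1..1} (poly p)"

lemma poly_int_add: "poly_int (p + q) = poly_int p + poly_int q"
proof -
  have "poly (p + q) = (\<lambda>x. poly p x + poly q x)" by auto
  then show ?thesis by (simp add: poly_int_def integral_add)
qed

lemma poly_int_smult: "poly_int (smult c p) = c * poly_int p"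
proof -
  have "poly (smult c p) = (\<lambda>x. c * poly p x)" by auto
  then show ?thesis by (simp add: poly_int_def)
qed

lemma poly_int_0 [simp]: "poly_int 0 = 0"
  using poly_int_smult[of 0 0] by simp

lemma poly_int_sum: "poly_int (sum f A) = (\<Sum>i\<in>A. poly_int (f i))"
  by (induction A rule: infinite_finite_induct) (auto simp: poly_int_add)

lemma poly_int_pderiv: "poly_int (pderiv p) = poly p 1 - poly p (-1)"
  unfolding poly_int_def by (intro integral_unique has_integral_derivative poly_DERIV) simp

lemma poly_int_by_parts:
  "poly_int (pderiv p * q) = poly p 1 * poly q 1 - poly p (-1) * poly q (-1) - poly_int (p * pderiv q)"
proof -
  have "poly_int (pderiv (p * q)) = poly_int (pderiv p * q) + poly_int (p * pderiv q)"
    by (simp add: pderiv_mult poly_int_add[symmetric] algebra_simps)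
  then show ?thesis by (simp add: poly_int_pderiv)
qed

lemma poly_int_square_nonneg: "poly_int (p * p) \<ge> 0"
  unfolding poly_int_def by (rule integral_nonneg) auto

text \<open>
  Rolle's theorem, counted: the gaps between consecutive elements of \<open>A\<close> contain distinct roots of the
  derivative. The bounds by \<open>Min A\<close> and \<open>Max A\<close> keep the root added in each induction step apart from
  the earlier ones.
\<close>
lemma Rolle_poly_roots:
  fixes p :: "real poly"
  assumes "finite A" "A \<noteq> {}" "\<forall>a\<in>A. poly p a = 0"
  shows "\<exists>B. finite B \<and> card B + 1 = card A \<and>
    (\<forall>b\<in>B. Min A < b \<and> b < Max A \<and> poly (pderiv p) b = 0)"
  using assms
proof (induction A rule: finite_linorder_max_induct)
  case empty
  then show ?case by simp
next
  case (insert m A)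
  show ?case
  proof (cases "A = {}")
    case True
    then show ?thesis by (intro exI[of _ "{}"]) auto
  next
    case False
    then obtain B where B: "finite B" "card B + 1 = card A"
      "\<And>b. b \<in> B \<Longrightarrow> Min A < b \<and> b < Max A \<and> poly (pderiv p) b = 0"
      using insert by auto
    have less: "Max A < m" using False insert.hyps by auto
    have "poly p (Max A) = poly p m"
      using insert.prems insert.hyps(1) False by auto
    then obtain z where z: "Max A < z" "z < m" "poly (pderiv p) z = 0"
      using poly_MVT[OF less, of p] less by auto
    have "z \<notin> B" using B(3) z(1) by fastforce
    moreover have "Max (insert m A) = m" "Min (insert m A) = Min A"
      using less False insert.hyps(1) by (auto simp: Max_insert2 Min_insert intro!: min_absorb2 
          less_imp_le order.strict_trans1[OF _ less])
    moreover have "Min A \<le> Max A" using False insert.hyps(1) by simp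
    ultimately show ?thesis
      using B z less insert.hyps
      by (intro exI[of _ "insert z B"]) (auto intro: less_trans dest: B(3))
  qed
qed

lemma power_dvd_pderiv:
  fixes p :: "real poly"
  assumes "[:-c, 1:] ^ Suc k dvd p"
  shows "[:-c, 1:] ^ k dvd pderiv p"
proof -
  obtain q where q: "p = [:-c, 1:] ^ Suc k * q" using assms by (elim dvdE)
  have "[:-c, 1:] ^ k dvd [:-c, 1:] ^ Suc k * pderiv q"
    by (intro dvd_mult2 dvd_power_le) auto
  moreover have "[:-c, 1:] ^ k dvd q * pderiv ([:-c, 1:] ^ Suc k)"
    unfolding pderiv_power_Suc by (intro dvd_mult dvd_mult2 dvd_smult dvd_refl)
  ultimately show ?thesis
    unfolding q pderiv_mult by (rule dvd_add)
qed

text \<open>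
  The derivatives of \<open>(x\<^sup>2 - 1) ^ n\<close>; for \<open>k = n\<close> this is the Legendre polynomial of degree \<open>n\<close> up to a
  constant (Rodrigues' formula). The intermediate derivatives are what integration by parts and the
  repeated use of Rolle's theorem run through.
\<close>
definition rodrigues :: "nat \<Rightarrow> nat \<Rightarrow> real poly" where
  "rodrigues n k = (pderiv ^^ k) ([:-1, 1:] ^ n * [:1, 1:] ^ n)"

lemma rodrigues_0: "rodrigues n 0 = [:-1, 1:] ^ n * [:1, 1:] ^ n"
  by (simp add: rodrigues_def)

lemma rodrigues_Suc: "rodrigues n (Suc k) = pderiv (rodrigues n k)"
  by (simp add: rodrigues_def)

lemma rodrigues_dvd:
  assumes "k \<le> n" "c = 1 \<or> c = -1"
  shows "[:-c, 1:] ^ (n - k) dvd rodrigues n k"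
  using assms(1)
proof (induction k)
  case 0
  then show ?case using assms(2) by (auto simp: rodrigues_0)
next
  case (Suc k)
  then have "[:-c, 1:] ^ Suc (n - Suc k) dvd rodrigues n k"
    by (simp add: Suc_diff_Suc)
  then show ?case unfolding rodrigues_Suc by (rule power_dvd_pderiv)
qed

lemma rodrigues_boundary:
  assumes "k < n"
  shows "poly (rodrigues n k) 1 = 0" "poly (rodrigues n k) (-1) = 0"
proof -
  have "[:-c, 1:] dvd rodrigues n k" if "c = 1 \<or> c = -1" for c
    using dvd_trans[OF dvd_power rodrigues_dvd[of k n c]] that assms by auto
  from this[of 1] this[of "-1"] show "poly (rodrigues n k) 1 = 0" "poly (rodrigues n k) (-1) = 0"
    by (auto simp: poly_eq_0_iff_dvd)
qed

text \<open>
  For \<open>k < n\<close> the endpoints \<open>1\<close> and \<open>-1\<close> are roots as well, so Rolle's theorem turns \<open>k\<close> interior roots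
  into \<open>k + 1\<close>.
\<close>
lemma rodrigues_roots:
  assumes "k \<le> n"
  shows "\<exists>A. finite A \<and> card A = k \<and> (\<forall>a\<in>A. -1 < a \<and> a < 1 \<and> poly (rodrigues n k) a = 0)"
  using assms
proof (induction k)
  case 0
  then show ?case by (intro exI[of _ "{}"]) auto
next
  case (Suc k)
  then obtain A where A: "finite A" "card A = k" "\<And>a. a \<in> A \<Longrightarrow> -1 < a \<and> a < 1 \<and> poly (rodrigues n k) a = 0"
    by auto
  let ?A = "insert (-1) (insert 1 A)"
  have "(-1::real) \<notin> insert 1 A" "1 \<notin> A" using A(3) by force+
  then have card: "card ?A = k + 2" using A by simp
  have "Min ?A = -1" using A by (intro Min_eqI) (auto intro: less_imp_le)
  moreover have "Max ?A = 1" using A by (intro Max_eqI) (auto intro: less_imp_le)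
  moreover have "\<forall>a\<in>?A. poly (rodrigues n k) a = 0"
    using A rodrigues_boundary[of k n] Suc by auto
  ultimately show ?case
    using Rolle_poly_roots[of ?A "rodrigues n k"] A(1) card unfolding rodrigues_Suc by fastforce
qed

lemma degree_rodrigues: "degree (rodrigues n k) = 2 * n - k"
proof (induction k)
  case 0
  have "degree ([:-1, 1:] ^ n * [:1, 1:] ^ n :: real poly) = 2 * n"
    by (subst degree_mult_eq) (auto simp: degree_power_eq)
  then show ?case by (simp add: rodrigues_0)
next
  case (Suc k)
  then show ?case by (simp add: rodrigues_Suc degree_pderiv)
qed

text \<open>
  Each integration by parts moves a derivative to \<open>q\<close> without boundary terms; after more than
  \<open>degree q\<close> steps nothing is left.
\<close>
lemma rodrigues_orthogonal:
  assumes "k \<le> n" "degree q < k"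
  shows "poly_int (rodrigues n k * q) = 0"
  using assms
proof (induction k arbitrary: q)
  case 0
  then show ?case by simp
next
  case (Suc k)
  have "poly_int (rodrigues n (Suc k) * q) = - poly_int (rodrigues n k * pderiv q)"
    using rodrigues_boundary[of k n] Suc.prems
    by (simp add: rodrigues_Suc poly_int_by_parts)
  also have "poly_int (rodrigues n k * pderiv q) = 0"
  proof (cases "degree q = 0")
    case True
    then have "pderiv q = 0" by (simp add: pderiv_eq_0_iff)
    then show ?thesis by simp
  next
    case False
    then show ?thesis using Suc by (intro Suc.IH) (auto simp: degree_pderiv)
  qed
  finally show ?case by simp
qed

lemma poly_eqI_card:
  fixes p q :: "real poly"
  assumes "finite A" "degree p < card A" "degree q < card A" "\<And>a. a \<in> A \<Longrightarrow> poly p a = poly q a"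
  shows "p = q"
proof (rule ccontr)
  assume "p \<noteq> q"
  then have ne: "p - q \<noteq> 0" by simp
  have "card A \<le> card {x. poly (p - q) x = 0}"
    using assms by (intro card_mono poly_roots_finite ne) auto
  also have "\<dots> \<le> degree (p - q)" by (rule card_poly_roots_bound[OF ne])
  also have "\<dots> < card A" using degree_diff_le_max[of p q] assms by (simp add: le_less_trans)
  finally show False by simp
qed

definition lagrange_basis :: "real set \<Rightarrow> real \<Rightarrow> real poly" where
  "lagrange_basis A a = (\<Prod>b\<in>A - {a}. smult (1 / (a - b)) [:-b, 1:])"

lemma poly_lagrange_basis:
  assumes "finite A" "a \<in> A" "c \<in> A"
  shows "poly (lagrange_basis A a) c = (if c = a then 1 else 0)"
proof (cases "c = a")
  case True
  have "(1 / (a - b)) * (a - b) = 1" if "b \<in> A - {a}" for b using that by simp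
  then show ?thesis
    using True by (auto simp: lagrange_basis_def poly_prod diff_divide_distrib[symmetric] intro!: prod.neutral)
next
  case False
  then show ?thesis
    using assms by (auto simp: lagrange_basis_def poly_prod intro!: prod_zero bexI[of _ c])
qed

lemma degree_lagrange_basis:
  assumes "finite A" "a \<in> A"
  shows "degree (lagrange_basis A a) < card A"
proof -
  have "degree (lagrange_basis A a) \<le> (\<Sum>b\<in>A - {a}. degree (smult (1 / (a - b)) [:-b, 1:]))"
    using degree_prod_sum_le[of "A - {a}" "\<lambda>b. smult (1 / (a - b)) [:-b, 1:]"] assms(1)
    unfolding lagrange_basis_def o_def by blast
  also have "\<dots> \<le> (\<Sum>b\<in>A - {a}. 1)"
    by (intro sum_mono order.trans[OF degree_smult_le]) simp
  also have "\<dots> = card A - 1" using assms by simp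
  also have "\<dots> < card A" using assms card_gt_0_iff[of A] by auto
  finally show ?thesis .
qed

lemma lagrange_interpolation:
  assumes "finite A" "degree p < card A"
  shows "p = (\<Sum>a\<in>A. smult (poly p a) (lagrange_basis A a))"
proof (rule poly_eqI_card[OF assms])
  have "A \<noteq> {}" using assms by auto
  show "degree (\<Sum>a\<in>A. smult (poly p a) (lagrange_basis A a)) < card A"
    using assms by (intro degree_sum_less le_less_trans[OF degree_smult_le degree_lagrange_basis]) auto
  fix c assume c: "c \<in> A"
  have "(\<Sum>a\<in>A. poly p a * poly (lagrange_basis A a) c) = (\<Sum>a\<in>A. if a = c then poly p a else 0)"
    using assms(1) c by (intro sum.cong) (auto simp: poly_lagrange_basis)
  then show "poly p c = poly (\<Sum>a\<in>A. smult (poly p a) (lagrange_basis A a)) c"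
    using assms(1) c by (simp add: poly_sum)
qed

text \<open>
  The nodes are the roots of the Legendre polynomial \<open>P\<close>, and the weights the integrals of the Lagrange
  basis. Division by \<open>P\<close> reduces a polynomial of degree below \<open>2 n\<close> to its remainder, since the quotient
  is orthogonal to \<open>P\<close>. The weight at \<open>a\<close> is also the integral of the square of the basis polynomial,
  whence it is nonnegative.
\<close>
theorem Gauss_quadrature:
  assumes n: "n \<ge> 1"
  shows "\<exists>A w. finite A \<and> card A = n \<and> (\<forall>a\<in>A. -1 < a \<and> a < 1 \<and> 0 \<le> w a) \<and>
    (\<forall>p. degree p < 2 * n \<longrightarrow> poly_int p = (\<Sum>a\<in>A. w a * poly p a))"
proof -
  obtain A where A: "finite A" "card A = n"
    "\<And>a. a \<in> A \<Longrightarrow> -1 < a \<and> a < 1 \<and> poly (rodrigues n n) a = 0"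
    using rodrigues_roots[of n n] by auto
  let ?P = "rodrigues n n"
  have degP: "degree ?P = n" by (simp add: degree_rodrigues)
  define w where "w = (\<lambda>a. poly_int (lagrange_basis A a))"
  have exact: "poly_int p = (\<Sum>a\<in>A. w a * poly p a)" if "degree p < 2 * n" for p
  proof -
    let ?q = "p div ?P" and ?r = "p mod ?P"
    have P0: "?P \<noteq> 0" using degP n by auto
    have p: "p = ?P * ?q + ?r" by simp
    have degr: "degree ?r < card A"
      using degree_mod_less[OF P0, of p] degP A(2) n by auto
    have degq: "degree ?q < n"
    proof (rule ccontr)
      assume big: "\<not> degree ?q < n"
      then have "degree (?P * ?q) \<ge> 2 * n"
        using P0 degP n by (subst degree_mult_eq) auto
      moreover have "?P * ?q = p - ?r" by (simp add: minus_mod_eq_mult_div)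
      then have "degree (?P * ?q) \<le> max (degree p) (degree ?r)"
        by (simp add: degree_diff_le_max)
      ultimately show False using that degr A(2) n by simp
    qed
    have pr: "poly p a = poly ?r a" if "a \<in> A" for a
      using arg_cong[OF p, of "\<lambda>p. poly p a"] A(3)[OF that] by (simp only: poly_add poly_mult)
    have "poly_int p = poly_int (?P * ?q) + poly_int ?r"
      by (subst p) (simp only: poly_int_add)
    also have "poly_int (?P * ?q) = 0"
      using degq by (intro rodrigues_orthogonal) auto
    also have "poly_int ?r = (\<Sum>a\<in>A. poly ?r a * w a)"
      by (subst lagrange_interpolation[OF A(1) degr]) (simp add: poly_int_sum poly_int_smult w_def)
    also have "\<dots> = (\<Sum>a\<in>A. w a * poly p a)"
      by (intro sum.cong) (auto simp: pr)
    finally show ?thesis by simp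
  qed
  have "0 \<le> w a" if a: "a \<in> A" for a
  proof -
    let ?l = "lagrange_basis A a"
    have "degree (?l * ?l) < 2 * n"
      using degree_lagrange_basis[OF A(1) a] A(2) degree_mult_le[of ?l ?l] by linarith
    then have "poly_int (?l * ?l) = (\<Sum>b\<in>A. w b * poly (?l * ?l) b)" by (rule exact)
    also have "\<dots> = (\<Sum>b\<in>A. if b = a then w b else 0)"
      using A(1) a by (intro sum.cong) (auto simp: poly_lagrange_basis)
    also have "\<dots> = w a" using A(1) a by simp
    finally show ?thesis using poly_int_square_nonneg[of ?l] by simp
  qed
  with exact A show ?thesis by blast
qed

section \<open>Chebyshev expansions and the Gauss error for polynomials\<close>

fun cheb :: "nat \<Rightarrow> real poly" where
  "cheb 0 = 1"
| "cheb (Suc 0) = [:0, 1:]"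
| "cheb (Suc (Suc k)) = [:0, 2:] * cheb (Suc k) - cheb k"

lemma poly_cheb_cos: "poly (cheb k) (cos \<theta>) = cos (real k * \<theta>)"
proof (induction k rule: cheb.induct)
  case (3 k)
  have "cos (real (Suc (Suc k)) * \<theta>) + cos (real k * \<theta>) = 2 * cos \<theta> * cos (real (Suc k) * \<theta>)"
    using cos_add[of "real (Suc k) * \<theta>" \<theta>] cos_diff[of "real (Suc k) * \<theta>" \<theta>]
    by (simp add: algebra_simps)
  then show ?case using 3 by (simp add: algebra_simps)
qed auto

lemma abs_poly_cheb_le_1:
  assumes "-1 \<le> x" "x \<le> 1"
  shows "\<bar>poly (cheb k) x\<bar> \<le> 1"
  using poly_cheb_cos[of k "arccos x"] assms by (simp add: cos_arccos)

lemma degree_cheb_le: "degree (cheb k) \<le> k"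
proof (induction k rule: cheb.induct)
  case (3 k)
  have "degree ([:0, 2:] * cheb (Suc k)) \<le> Suc (Suc k)"
    using degree_mult_le[of "[:0, 2:]" "cheb (Suc k)"] 3 by simp
  then show ?case using 3 by (auto intro!: degree_diff_le)
qed auto

lemma coeff_cheb_ne_0: "coeff (cheb k) k \<noteq> 0"
proof -
  have "coeff (cheb (Suc k)) (Suc k) = 2 ^ k" for k
  proof (induction k)
    case (Suc k)
    have "coeff (cheb k) (Suc (Suc k)) = 0"
      using degree_cheb_le[of k] by (intro coeff_eq_0) auto
    then show ?case using Suc by simp
  qed auto
  then show ?thesis by (cases k) auto
qed

lemma cheb_expansion:
  assumes "degree p \<le> K"
  shows "\<exists>c. p = (\<Sum>k\<le>K. smult (c k) (cheb k))"
  using assms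
proof (induction K arbitrary: p)
  case 0
  then have "degree p = 0" by simp
  then obtain a where "p = [:a:]" by (elim degree_eq_zeroE)
  then show ?case by (intro exI[of _ "\<lambda>_. a"]) simp
next
  case (Suc K)
  define a where "a = coeff p (Suc K) / coeff (cheb (Suc K)) (Suc K)"
  let ?q = "p - smult a (cheb (Suc K))"
  have "degree ?q \<le> Suc K"
    using Suc.prems degree_cheb_le[of "Suc K"] by (auto intro!: degree_diff_le order.trans[OF degree_smult_le])
  moreover have "coeff ?q (Suc K) = 0"
    using coeff_cheb_ne_0[of "Suc K"] by (simp add: a_def)
  ultimately have "degree ?q \<le> K"
    by (metis eq_zero_or_degree_less less_Suc_eq_le degree_0 le0)
  then obtain c where c: "?q = (\<Sum>k\<le>K. smult (c k) (cheb k))" using Suc.IH by blast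
  have "p = (\<Sum>k\<le>Suc K. smult ((c(Suc K := a)) k) (cheb k))"
    using c by (simp add: algebra_simps)
  then show ?case by blast
qed

lemma poly_fun_eq_on_Icc:
  fixes p q :: "real poly"
  assumes "\<And>x. x \<in> {-1..1} \<Longrightarrow> poly p x = poly q x"
  shows "p = q"
proof (rule ccontr)
  assume "p \<noteq> q"
  then have "finite {x. poly (p - q) x = 0}" by (intro poly_roots_finite) simp
  moreover have "{-1..1} \<subseteq> {x. poly (p - q) x = 0}" using assms by auto
  ultimately have "finite {-1..1::real}" by (rule finite_subset[rotated])
  then show False by (simp add: infinite_Icc)
qed

lemma poly_cos_DERIV:
  "((\<lambda>\<theta>. poly p (cos \<theta>)) has_real_derivative (- poly (pderiv p) (cos \<theta>) * sin \<theta>)) (at \<theta>)"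
  by (rule derivative_eq_intros | rule poly_DERIV[THEN DERIV_chain2] | simp)+

text \<open>
  The differential equation of the derivatives of the Chebyshev polynomials. For \<open>s = 0\<close> it is
  \<open>(cos (k \<theta>))'' = - k\<^sup>2 cos (k \<theta>)\<close> in the variable \<open>x = cos \<theta>\<close>; each further case is the derivative
  of the preceding one.
\<close>
lemma cheb_ode:
  "(1 - x\<^sup>2) * poly ((pderiv ^^ Suc (Suc s)) (cheb k)) x
     - (2 * real s + 1) * x * poly ((pderiv ^^ Suc s) (cheb k)) x
     + ((real k)\<^sup>2 - (real s)\<^sup>2) * poly ((pderiv ^^ s) (cheb k)) x = 0"
proof (induction s arbitrary: x)
  case 0
  let ?T = "cheb k"
  have d1: "poly (pderiv ?T) (cos \<theta>) * sin \<theta> = real k * sin (real k * \<theta>)" for \<theta>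
  proof -
    have "((\<lambda>\<theta>. poly ?T (cos \<theta>)) has_real_derivative - (real k * sin (real k * \<theta>))) (at \<theta>)"
      unfolding poly_cheb_cos by (auto intro!: derivative_eq_intros)
    from DERIV_unique[OF this poly_cos_DERIV] show ?thesis by simp
  qed
  have d2: "- poly (pderiv (pderiv ?T)) (cos \<theta>) * sin \<theta> * sin \<theta> + cos \<theta> * poly (pderiv ?T) (cos \<theta>)
      = (real k)\<^sup>2 * cos (real k * \<theta>)" for \<theta>
  proof -
    have "((\<lambda>\<theta>. poly (pderiv ?T) (cos \<theta>) * sin \<theta>) has_real_derivative
        - poly (pderiv (pderiv ?T)) (cos \<theta>) * sin \<theta> * sin \<theta> + cos \<theta> * poly (pderiv ?T) (cos \<theta>)) (at \<theta>)"
      by (rule DERIV_mult'[OF poly_cos_DERIV DERIV_sin, THEN DERIV_cong]) (simp add: algebra_simps)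
    moreover have "((\<lambda>\<theta>. poly (pderiv ?T) (cos \<theta>) * sin \<theta>) has_real_derivative
        (real k)\<^sup>2 * cos (real k * \<theta>)) (at \<theta>)"
      unfolding d1 by (auto intro!: derivative_eq_intros simp: power2_eq_square)
    ultimately show ?thesis by (rule DERIV_unique)
  qed
  have "[:1, 0, -1:] * pderiv (pderiv ?T) - [:0, 1:] * pderiv ?T + smult ((real k)\<^sup>2) ?T = 0"
  proof (rule poly_fun_eq_on_Icc)
    fix x :: real assume x: "x \<in> {-1..1}"
    define \<theta> where "\<theta> = arccos x"
    have c: "cos \<theta> = x" using x by (simp add: \<theta>_def cos_arccos)
    have "sin \<theta> * sin \<theta> = 1 - x * x"
      using sin_cos_squared_add[of \<theta>] c by (simp add: power2_eq_square)
    with d2[of \<theta>] c have "- poly (pderiv (pderiv ?T)) x * (1 - x * x) + x * poly (pderiv ?T) x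
        = (real k)\<^sup>2 * cos (real k * \<theta>)"
      by (simp only: mult.assoc)
    with poly_cheb_cos[of k \<theta>] c
    show "poly ([:1, 0, -1:] * pderiv (pderiv ?T) - [:0, 1:] * pderiv ?T + smult ((real k)\<^sup>2) ?T) x = poly 0 x"
      by (simp add: algebra_simps)
  qed
  from arg_cong[OF this, of "\<lambda>p. poly p x"] show ?case
    by (simp add: power2_eq_square algebra_simps)
next
  case (Suc s)
  let ?D = "\<lambda>j. (pderiv ^^ j) (cheb k)"
  have d: "(poly (?D j) has_real_derivative poly (?D (Suc j)) x) (at x)" for j
    using poly_DERIV[of "?D j" x] by simp
  have "((\<lambda>x. (1 - x\<^sup>2) * poly (?D (Suc (Suc s))) x - (2 * real s + 1) * x * poly (?D (Suc s)) x
       + ((real k)\<^sup>2 - (real s)\<^sup>2) * poly (?D s) x) has_real_derivative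
     ((1 - x\<^sup>2) * poly (?D (Suc (Suc (Suc s)))) x - (2 * real (Suc s) + 1) * x * poly (?D (Suc (Suc s))) x
       + ((real k)\<^sup>2 - (real (Suc s))\<^sup>2) * poly (?D (Suc s)) x)) (at x)"
    by (rule derivative_eq_intros d refl)+ (simp add: algebra_simps power2_eq_square)
  moreover have "((\<lambda>x. (1 - x\<^sup>2) * poly (?D (Suc (Suc s))) x - (2 * real s + 1) * x * poly (?D (Suc s)) x
       + ((real k)\<^sup>2 - (real s)\<^sup>2) * poly (?D s) x) has_real_derivative 0) (at x)"
    unfolding Suc.IH by simp
  ultimately show ?case by (rule DERIV_unique)
qed

text \<open>
  The inner product of the \<open>s\<close>-th derivatives with weight \<open>(1 - x\<^sup>2) powr (s - 1/2)\<close> on \<open>[-1, 1]\<close>, written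
  in the variable \<open>x = cos \<theta>\<close>, in which the integrand is smooth.
\<close>
definition cheb_form :: "nat \<Rightarrow> real poly \<Rightarrow> real poly \<Rightarrow> real" where
  "cheb_form s p q = integral {0..pi}
     (\<lambda>\<theta>. poly ((pderiv ^^ s) p) (cos \<theta>) * poly ((pderiv ^^ s) q) (cos \<theta>) * sin \<theta> ^ (2 * s))"

lemma cheb_form_integrable:
  "(\<lambda>\<theta>. poly ((pderiv ^^ s) p) (cos \<theta>) * poly ((pderiv ^^ s) q) (cos \<theta>) * sin \<theta> ^ (2 * s))
     integrable_on {0..pi}"
  by (intro integrable_continuous_real continuous_intros)

lemma cheb_form_commute: "cheb_form s p q = cheb_form s q p"
  by (simp add: cheb_form_def mult.commute)

lemma cheb_form_sum:
  "cheb_form s (\<Sum>k\<in>I. smult (c k) (p k)) q = (\<Sum>k\<in>I. c k * cheb_form s (p k) q)"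
proof (cases "finite I")
  case True
  have lin: "(pderiv ^^ s) (\<Sum>k\<in>I. smult (c k) (p k)) = (\<Sum>k\<in>I. smult (c k) ((pderiv ^^ s) (p k)))"
    by (simp add: higher_pderiv_sum higher_pderiv_smult)
  have "cheb_form s (\<Sum>k\<in>I. smult (c k) (p k)) q = integral {0..pi} (\<lambda>\<theta>. \<Sum>k\<in>I. c k *
      (poly ((pderiv ^^ s) (p k)) (cos \<theta>) * poly ((pderiv ^^ s) q) (cos \<theta>) * sin \<theta> ^ (2 * s)))"
    unfolding cheb_form_def lin
    by (rule integral_cong) (simp add: poly_sum sum_distrib_left sum_distrib_right mult_ac)
  also have "\<dots> = (\<Sum>k\<in>I. c k * cheb_form s (p k) q)"
    unfolding cheb_form_def using True
    by (subst integral_sum) (auto intro!: integrable_on_mult_right cheb_form_integrable)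
  finally show ?thesis .
next
  case False
  then show ?thesis by (simp add: cheb_form_def)
qed

text \<open>
  Multiply \<open>sin \<theta> ^ (2 s + 1)\<close> by the derivatives of order \<open>s + 1\<close> of \<open>cheb k\<close> and of order \<open>s\<close> of \<open>q\<close>
  at \<open>cos \<theta>\<close>. This product vanishes at \<open>0\<close> and \<open>\<pi>\<close>, and by the differential equation its derivative is
  the difference of the integrands of the two sides.
\<close>
lemma cheb_form_Suc:
  "cheb_form (Suc s) (cheb k) q = ((real k)\<^sup>2 - (real s)\<^sup>2) * cheb_form s (cheb k) q"
proof -
  let ?D = "\<lambda>j. (pderiv ^^ j) (cheb k)" and ?q = "\<lambda>j. (pderiv ^^ j) q"
  let ?F = "\<lambda>j \<theta>. poly (?D j) (cos \<theta>) * poly (?q j) (cos \<theta>) * sin \<theta> ^ (2 * j)"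
  let ?G = "\<lambda>\<theta>. sin \<theta> ^ (2 * s + 1) * poly (?D (Suc s)) (cos \<theta>) * poly (?q s) (cos \<theta>)"
  let ?c = "(real k)\<^sup>2 - (real s)\<^sup>2"
  have d: "((\<lambda>\<theta>. poly ((pderiv ^^ j) r) (cos \<theta>)) has_real_derivative
      - poly ((pderiv ^^ Suc j) r) (cos \<theta>) * sin \<theta>) (at \<theta>)" for r :: "real poly" and j \<theta>
    using poly_cos_DERIV[of "(pderiv ^^ j) r"] by simp
  have deriv: "(?G has_real_derivative (?c * ?F s \<theta> - ?F (Suc s) \<theta>)) (at \<theta>)" for \<theta>
  proof -
    define S C q0 q1 D0 D1 D2 where "S = sin \<theta>" and "C = cos \<theta>"
      and "q0 = poly (?q s) (cos \<theta>)" and "q1 = poly (?q (Suc s)) (cos \<theta>)"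
      and "D0 = poly (?D s) (cos \<theta>)" and "D1 = poly (?D (Suc s)) (cos \<theta>)"
      and "D2 = poly (?D (Suc (Suc s))) (cos \<theta>)"
    note defs = S_def C_def q0_def q1_def D0_def D1_def D2_def
    have "(?G has_real_derivative
       ((2 * real s + 1) * S ^ (2 * s) * C * D1 + S ^ (2 * s + 1) * (- D2 * S)) * q0
         + S ^ (2 * s + 1) * D1 * (- q1 * S)) (at \<theta>)"
      unfolding defs
      by (rule derivative_eq_intros d refl)+ (simp add: algebra_simps del: funpow.simps)
    moreover have "?c * D0 = (2 * real s + 1) * C * D1 - S\<^sup>2 * D2"
      using cheb_ode[of "cos \<theta>" s k]
      unfolding defs sin_squared_eq by (simp add: algebra_simps del: funpow.simps)
    then have "?c * (D0 * q0 * S ^ (2 * s)) - D1 * q1 * S ^ (2 * Suc s) =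
      ((2 * real s + 1) * S ^ (2 * s) * C * D1 + S ^ (2 * s + 1) * (- D2 * S)) * q0
         + S ^ (2 * s + 1) * D1 * (- q1 * S)"
      by (simp add: mult.assoc[symmetric]) (simp add: algebra_simps power2_eq_square)
    ultimately show ?thesis unfolding defs by (simp only:)
  qed
  have "((\<lambda>\<theta>. ?c * ?F s \<theta> - ?F (Suc s) \<theta>) has_integral (?G pi - ?G 0)) {0..pi}"
    by (rule has_integral_derivative[OF pi_ge_zero deriv])
  moreover have "?G pi - ?G 0 = 0" by simp
  ultimately have "((\<lambda>\<theta>. ?c * ?F s \<theta> - ?F (Suc s) \<theta>) has_integral 0) {0..pi}"
    by (simp only:)
  moreover have "((\<lambda>\<theta>. ?c * ?F s \<theta> - ?F (Suc s) \<theta>) has_integral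
      (?c * cheb_form s (cheb k) q - cheb_form (Suc s) (cheb k) q)) {0..pi}"
    unfolding cheb_form_def
    by (intro has_integral_diff has_integral_mult_right integrable_integral cheb_form_integrable)
  ultimately have "0 = ?c * cheb_form s (cheb k) q - cheb_form (Suc s) (cheb k) q"
    by (rule has_integral_unique)
  then show ?thesis by simp
qed

text \<open>
  By the recursion just shown, the factor by which passing from the values to the \<open>s\<close>-th derivatives
  multiplies the inner product with the \<open>k\<close>-th Chebyshev polynomial.
\<close>
definition cheb_eig :: "nat \<Rightarrow> nat \<Rightarrow> real" where
  "cheb_eig s k = (\<Prod>j<s. (real k)\<^sup>2 - (real j)\<^sup>2)"

lemma cheb_form_eig: "cheb_form s (cheb k) q = cheb_eig s k * cheb_form 0 (cheb k) q"
  by (induction s) (auto simp: cheb_eig_def cheb_form_Suc)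

lemma has_integral_cos_int:
  fixes m :: int
  shows "((\<lambda>\<theta>. cos (of_int m * \<theta>)) has_integral (if m = 0 then pi else 0)) {0..pi}"
proof (cases "m = 0")
  case True
  then show ?thesis using has_integral_const_real[of "1::real" 0 pi] by simp
next
  case False
  have "((\<lambda>\<theta>. cos (of_int m * \<theta>)) has_integral
      (sin (of_int m * pi) / of_int m - sin (of_int m * 0) / of_int m)) {0..pi}"
    by (rule has_integral_derivative) (use False in \<open>auto intro!: derivative_eq_intros\<close>)
  moreover have "sin (of_int m * pi) = 0"
    by (metis mult.commute sin_int_times_real sin_integer_2pi sin_times_pi_eq_0 Ints_of_int)
  ultimately show ?thesis using False by simp
qed

lemma cheb_form_0:
  assumes "k \<ge> 1"
  shows "cheb_form 0 (cheb k) (cheb l) = (if k = l then pi / 2 else 0)"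
proof -
  have "((\<lambda>\<theta>. (1/2) * (cos (of_int (int k - int l) * \<theta>) + cos (of_int (int k + int l) * \<theta>))) has_integral
     (1/2) * ((if int k - int l = 0 then pi else 0) + (if int k + int l = 0 then pi else 0))) {0..pi}"
    by (intro has_integral_mult_right has_integral_add has_integral_cos_int)
  moreover have "(1/2) * (cos (of_int (int k - int l) * \<theta>) + cos (of_int (int k + int l) * \<theta>)) =
      cos (real k * \<theta>) * cos (real l * \<theta>)" for \<theta>
    by (simp add: cos_times_cos algebra_simps)
  ultimately show ?thesis
    using assms by (auto simp: cheb_form_def poly_cheb_cos integral_unique)
qed

text \<open>
  The mean of \<open>sin \<theta> ^ (2 s)\<close> over \<open>[0, \<pi>]\<close>, that is \<open>(2 s choose s) / 4 ^ s\<close>.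
\<close>
definition sin_mean :: "nat \<Rightarrow> real" where
  "sin_mean s = (\<Prod>j<s. (2 * real j + 1) / (2 * real j + 2))"

lemma has_integral_sin_power:
  "((\<lambda>\<theta>. sin \<theta> ^ (2 * s)) has_integral (pi * sin_mean s)) {0..pi}"
proof (induction s)
  case 0
  then show ?case using has_integral_const_real[of "1::real" 0 pi] by (simp add: sin_mean_def)
next
  case (Suc s)
  let ?I = "integral {0..pi} (\<lambda>\<theta>. sin \<theta> ^ (2 * Suc s))"
  have I: "((\<lambda>\<theta>. sin \<theta> ^ (2 * Suc s)) has_integral ?I) {0..pi}"
    by (intro integrable_integral integrable_continuous_real continuous_intros)
  let ?G = "\<lambda>\<theta>. sin \<theta> ^ (2 * s + 1) * cos \<theta>"
  have "(?G has_real_derivative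
      ((2 * real s + 1) * sin \<theta> ^ (2 * s) - (2 * real s + 2) * sin \<theta> ^ (2 * Suc s))) (at \<theta>)" for \<theta>
  proof -
    have "(?G has_real_derivative
      (2 * real s + 1) * sin \<theta> ^ (2 * s) * (cos \<theta>)\<^sup>2 - sin \<theta> ^ (2 * Suc s)) (at \<theta>)"
      by (rule derivative_eq_intros refl)+ (simp add: power2_eq_square algebra_simps)
    then show ?thesis
      by (rule DERIV_cong) (unfold cos_squared_eq, simp add: algebra_simps power2_eq_square)
  qed
  then have "((\<lambda>\<theta>. (2 * real s + 1) * sin \<theta> ^ (2 * s) - (2 * real s + 2) * sin \<theta> ^ (2 * Suc s))
      has_integral (?G pi - ?G 0)) {0..pi}"
    by (intro has_integral_derivative pi_ge_zero)
  moreover have "((\<lambda>\<theta>. (2 * real s + 1) * sin \<theta> ^ (2 * s) - (2 * real s + 2) * sin \<theta> ^ (2 * Suc s))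
      has_integral ((2 * real s + 1) * (pi * sin_mean s) - (2 * real s + 2) * ?I)) {0..pi}"
    by (intro has_integral_diff has_integral_mult_right Suc.IH I)
  ultimately have "(2 * real s + 1) * (pi * sin_mean s) - (2 * real s + 2) * ?I = ?G pi - ?G 0"
    using has_integral_unique by blast
  then have "?I = pi * sin_mean (Suc s)"
    by (simp add: sin_mean_def field_simps)
  then show ?case using I by simp
qed

text \<open>
  Parseval's identity for the \<open>s\<close>-th derivative: \<open>cheb_form s p p\<close> is \<open>\<pi>/2\<close> times the left-hand side,
  because the Chebyshev polynomials are orthogonal for this form, and it is at most \<open>M\<^sup>2\<close> times the
  integral \<open>\<pi> sin_mean s\<close> of the weight. The index 0 drops out, as \<open>cheb_eig s 0 = 0\<close> for \<open>s \<ge> 1\<close>.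
\<close>
lemma cheb_coeffs_weighted_bound:
  assumes p: "p = (\<Sum>k\<le>K. smult (c k) (cheb k))" and s: "s \<ge> 1"
    and M: "\<And>x. x \<in> {-1..1} \<Longrightarrow> \<bar>poly ((pderiv ^^ s) p) x\<bar> \<le> M"
  shows "(\<Sum>k\<in>{1..K}. (c k)\<^sup>2 * cheb_eig s k) \<le> 2 * M\<^sup>2 * sin_mean s"
proof -
  have c: "cheb_form 0 (cheb k) p = pi / 2 * c k" if "k \<in> {1..K}" for k
  proof -
    have "cheb_form 0 (cheb k) p = (\<Sum>l\<le>K. c l * cheb_form 0 (cheb k) (cheb l))"
      unfolding p by (subst cheb_form_commute, subst cheb_form_sum) (simp add: cheb_form_commute)
    also have "\<dots> = (\<Sum>l\<le>K. if l = k then c l * (pi / 2) else 0)"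
      using that by (intro sum.cong) (auto simp: cheb_form_0)
    also have "\<dots> = pi / 2 * c k" using that by simp
    finally show ?thesis .
  qed
  have e0: "cheb_eig s 0 = 0"
    using s by (auto simp: cheb_eig_def intro!: bexI[of _ 0])
  have "cheb_form s p p = (\<Sum>k\<le>K. c k * cheb_form s (cheb k) p)"
    by (subst (1) p) (rule cheb_form_sum)
  also have "\<dots> = (\<Sum>k\<le>K. c k * cheb_eig s k * cheb_form 0 (cheb k) p)"
    by (subst cheb_form_eig) (simp add: mult.assoc)
  also have "\<dots> = (\<Sum>k\<in>{1..K}. c k * cheb_eig s k * cheb_form 0 (cheb k) p)"
    by (rule sum.mono_neutral_right) (auto simp: e0 Suc_le_eq)
  also have "\<dots> = (\<Sum>k\<in>{1..K}. pi / 2 * ((c k)\<^sup>2 * cheb_eig s k))"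
    by (intro sum.cong) (auto simp: c power2_eq_square)
  finally have "cheb_form s p p = pi / 2 * (\<Sum>k\<in>{1..K}. (c k)\<^sup>2 * cheb_eig s k)"
    by (simp add: sum_distrib_left)
  moreover have "cheb_form s p p \<le> M\<^sup>2 * (pi * sin_mean s)"
    unfolding cheb_form_def
  proof (rule has_integral_le[OF integrable_integral[OF cheb_form_integrable]
        has_integral_mult_right[OF has_integral_sin_power]])
    fix \<theta> :: real
    let ?v = "poly ((pderiv ^^ s) p) (cos \<theta>)"
    have "?v * ?v = \<bar>?v\<bar>\<^sup>2" by (simp add: power2_eq_square)
    also have "\<dots> \<le> M\<^sup>2" using M[of "cos \<theta>"] by (intro power_mono) auto
    finally show "?v * ?v * sin \<theta> ^ (2 * s) \<le> M\<^sup>2 * sin \<theta> ^ (2 * s)"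
      by (intro mult_right_mono) (auto simp: power_mult)
  qed
  ultimately have "pi / 2 * (\<Sum>k\<in>{1..K}. (c k)\<^sup>2 * cheb_eig s k) \<le> M\<^sup>2 * (pi * sin_mean s)"
    by (simp only:)
  also have "\<dots> = pi / 2 * (2 * M\<^sup>2 * sin_mean s)" by simp
  finally show ?thesis by (simp only: mult_le_cancel_left_pos pi_half_gt_zero)
qed

text \<open>
  Written as \<open>(k - j) (k + j)\<close>, the factors of the two products agree up to those at the ends.
\<close>
lemma cheb_eig_shift:
  "cheb_eig s (Suc k) * (real k * (real k - real s + 1)) = cheb_eig s k * ((real k + 1) * (real k + real s))"
proof (induction s)
  case 0
  then show ?case by (simp add: cheb_eig_def algebra_simps)
next
  case (Suc s)
  have "cheb_eig (Suc s) (Suc k) * (real k * (real k - real (Suc s) + 1)) =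
    cheb_eig s (Suc k) * (real k * (real k - real s + 1)) * ((real k + 1 + real s) * (real k - real s))"
    by (simp add: cheb_eig_def power2_eq_square algebra_simps)
  also have "\<dots> = cheb_eig s k * ((real k + 1) * (real k + real s)) * ((real k + 1 + real s) * (real k - real s))"
    unfolding Suc.IH ..
  also have "\<dots> = cheb_eig (Suc s) k * ((real k + 1) * (real k + real (Suc s)))"
    by (simp add: cheb_eig_def power2_eq_square algebra_simps)
  finally show ?case .
qed

lemma cheb_eig_pos: "s \<le> k \<Longrightarrow> k \<ge> 1 \<Longrightarrow> cheb_eig s k > 0"
  unfolding cheb_eig_def by (intro prod_pos) (auto intro: power_strict_mono)

text \<open>
  The right-hand side, as a function of \<open>N\<close>, drops by at least the term \<open>1 / cheb_eig s N\<close> when \<open>N\<close>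
  grows by 1, so the sum telescopes.
\<close>
lemma sum_inverse_cheb_eig_le:
  assumes s: "s \<ge> 1" and N: "s \<le> N"
  shows "(\<Sum>k\<in>{N..K}. 1 / cheb_eig s k) \<le> (real N + real s) / ((2 * real s - 1) * cheb_eig s N)"
proof -
  let ?F = "\<lambda>k. (real k + real s) / ((2 * real s - 1) * cheb_eig s k)"
  have step: "1 / cheb_eig s k \<le> ?F k - ?F (Suc k)" if k: "N \<le> k" for k
  proof -
    define a b x y where "a = cheb_eig s k" and "b = cheb_eig s (Suc k)" and "x = real k" and "y = real s"
    have pos: "a > 0" "b > 0" "x \<ge> y" "y \<ge> 1"
      using s N k cheb_eig_pos[of s k] cheb_eig_pos[of s "Suc k"] by (auto simp: a_def b_def x_def y_def)
    have eq: "b * (x * (x - y + 1)) = a * ((x + 1) * (x + y))"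
      using cheb_eig_shift[of s k] by (simp add: a_def b_def x_def y_def)
    have "a * (x + 1 + y) * (x * (x - y + 1)) \<le> a * ((x + 1) * (x + y)) * (x - y + 1)"
    proof -
      have "(x + 1 + y) * x \<le> (x + 1) * (x + y)" using pos by (simp add: algebra_simps)
      then have "a * (x - y + 1) * ((x + 1 + y) * x) \<le> a * (x - y + 1) * ((x + 1) * (x + y))"
        using pos by (intro mult_left_mono) auto
      then show ?thesis by (simp add: mult_ac)
    qed
    also have "\<dots> = b * (x - y + 1) * (x * (x - y + 1))" unfolding eq[symmetric] by (simp add: mult_ac)
    finally have "a * (x + 1 + y) \<le> b * (x - y + 1)"
      using pos by (subst (asm) mult_le_cancel_right_pos) auto
    then have "(x + 1 + y) / b \<le> (x - y + 1) / a"
      using pos by (simp add: divide_simps mult_ac)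
    moreover have "(x - y + 1) / a = (x + y) / a - 1 / a * (2 * y - 1)"
      using pos by (simp add: divide_simps)
    ultimately have "1 / a * (2 * y - 1) \<le> (x + y) / a - (x + 1 + y) / b"
      by linarith
    then have "1 / a \<le> ((x + y) / a - (x + 1 + y) / b) / (2 * y - 1)"
      using pos by (simp add: pos_le_divide_eq)
    also have "\<dots> = (x + y) / ((2 * y - 1) * a) - (x + 1 + y) / ((2 * y - 1) * b)"
      by (simp add: diff_divide_distrib mult.commute)
    finally show ?thesis by (simp add: a_def b_def x_def y_def add_ac)
  qed
  have F: "?F k \<ge> 0" if "N \<le> k" for k
    using s N that cheb_eig_pos[of s k] by auto
  show ?thesis
  proof (cases "N \<le> K")
    case True
    have "(\<Sum>k\<in>{N..K}. 1 / cheb_eig s k) \<le> (\<Sum>k\<in>{N..K}. ?F k - ?F (Suc k))"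
      by (intro sum_mono step) simp
    also have "\<dots> = ?F N - ?F (Suc K)"
      using sum_Suc_diff[of N K "\<lambda>k. - ?F k"] True by simp
    also have "\<dots> \<le> ?F N" using F[of "Suc K"] True by simp
    finally show ?thesis .
  next
    case False
    then show ?thesis using F[of N] by simp
  qed
qed

text \<open>
  The polynomial \<open>T\<^sub>k\<^sub>+\<^sub>1 / (2 (k + 1)) - T\<^sub>k\<^sub>-\<^sub>1 / (2 (k - 1))\<close> is an antiderivative of \<open>T\<^sub>k\<close>, and Chebyshev
  polynomials are bounded by 1.
\<close>
lemma abs_poly_int_cheb_le:
  assumes k: "k \<ge> 2"
  shows "\<bar>poly_int (cheb k)\<bar> \<le> 2 * real k / ((real k)\<^sup>2 - 1)"
proof -
  let ?A = "smult (1 / (2 * (real k + 1))) (cheb (k + 1)) - smult (1 / (2 * (real k - 1))) (cheb (k - 1))"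
  have eq: "poly (pderiv ?A) (cos \<theta>) * sin \<theta> = poly (cheb k) (cos \<theta>) * sin \<theta>" for \<theta>
  proof -
    define a b where "a = real k + 1" and "b = real k - 1"
    have ab: "a \<noteq> 0" "b \<noteq> 0" "real (k + 1) = a" "real (k - 1) = b"
      using k by (auto simp: a_def b_def of_nat_diff)
    have "poly ?A (cos \<theta>) = 1 / (2 * a) * cos (a * \<theta>) - 1 / (2 * b) * cos (b * \<theta>)" for \<theta>
      unfolding poly_diff poly_smult poly_cheb_cos ab a_def[symmetric] b_def[symmetric] ..
    moreover have "((\<lambda>\<theta>. 1 / (2 * a) * cos (a * \<theta>) - 1 / (2 * b) * cos (b * \<theta>)) has_real_derivative
      1 / 2 * (sin (b * \<theta>) - sin (a * \<theta>))) (at \<theta>)"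
      using ab(1,2) by (auto intro!: derivative_eq_intros simp: algebra_simps)
    ultimately have "((\<lambda>\<theta>. poly ?A (cos \<theta>)) has_real_derivative
      1 / 2 * (sin ((real k - 1) * \<theta>) - sin ((real k + 1) * \<theta>))) (at \<theta>)"
      by (simp only: a_def b_def)
    from DERIV_unique[OF this poly_cos_DERIV]
    have "poly (pderiv ?A) (cos \<theta>) * sin \<theta> = 1 / 2 * (sin ((real k + 1) * \<theta>) - sin ((real k - 1) * \<theta>))"
      by simp
    also have "\<dots> = cos (real k * \<theta>) * sin \<theta>"
      by (simp add: algebra_simps sin_add sin_diff)
    finally show ?thesis by (simp add: poly_cheb_cos)
  qed
  have "[:1, 0, -1:] * pderiv ?A = [:1, 0, -1:] * cheb k"
  proof (rule poly_fun_eq_on_Icc)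
    fix x :: real assume x: "x \<in> {-1..1}"
    have "(1 - x\<^sup>2) = sin (arccos x) * sin (arccos x)"
      using x sin_cos_squared_add[of "arccos x"] by (simp add: cos_arccos power2_eq_square)
    moreover have "poly ([:1, 0, -1:] * q) x = (1 - x\<^sup>2) * poly q x" for q
      by (simp add: algebra_simps power2_eq_square)
    ultimately have m: "poly ([:1, 0, -1:] * q) x = poly q x * sin (arccos x) * sin (arccos x)" for q
      by simp
    have "poly (pderiv ?A) x * sin (arccos x) * sin (arccos x) =
        poly (cheb k) x * sin (arccos x) * sin (arccos x)"
      using eq[of "arccos x"] x by (simp add: cos_arccos del: mult_cancel_right)
    then show "poly ([:1, 0, -1:] * pderiv ?A) x = poly ([:1, 0, -1:] * cheb k) x"
      by (simp only: m)
  qed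
  then have "pderiv ?A = cheb k" by (metis mult_left_cancel one_neq_zero pCons_eq_0_iff)
  then have "poly_int (cheb k) = poly ?A 1 - poly ?A (-1)"
    using poly_int_pderiv[of ?A] by simp
  moreover have "\<bar>poly ?A x\<bar> \<le> real k / ((real k)\<^sup>2 - 1)" if "x = 1 \<or> x = -1" for x
  proof -
    have "\<bar>poly ?A x\<bar> \<le> \<bar>1 / (2 * (real k + 1))\<bar> * \<bar>poly (cheb (k + 1)) x\<bar>
       + \<bar>1 / (2 * (real k - 1))\<bar> * \<bar>poly (cheb (k - 1)) x\<bar>"
      by (simp add: abs_mult[symmetric] order.trans[OF abs_triangle_ineq4])
    also have "\<dots> \<le> \<bar>1 / (2 * (real k + 1))\<bar> * 1 + \<bar>1 / (2 * (real k - 1))\<bar> * 1"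
      using that by (intro add_mono mult_left_mono abs_poly_cheb_le_1) auto
    also have "\<dots> = real k / ((real k + 1) * (real k - 1))"
      using k by (simp add: divide_simps) (simp add: algebra_simps)
    also have "(real k + 1) * (real k - 1) = (real k)\<^sup>2 - 1"
      by (simp add: algebra_simps power2_eq_square)
    finally show ?thesis .
  qed
  from this[of 1] this[of "-1"] have "\<bar>poly ?A 1 - poly ?A (-1)\<bar> \<le> 2 * (real k / ((real k)\<^sup>2 - 1))"
    by linarith
  ultimately show ?thesis by simp
qed

text \<open>
  Expand \<open>p\<close> in Chebyshev polynomials. The rule is exact for those of degree below \<open>2 n\<close>; for the others
  its error is at most \<open>2 + 16/63 = 2 (71/63)\<close>, where 2 is the sum of the weights and \<open>16/63\<close> bounds the
  integral because \<open>k \<ge> 2 n \<ge> 8\<close>. The Cauchy-Schwarz inequality with the weights \<open>cheb_eig s k\<close> then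
  combines the bound for the coefficients with the tail sum.
\<close>
lemma Gauss_poly_error:
  assumes n: "n \<ge> 4" and s: "1 \<le> s" "s \<le> 2 * n"
    and A: "finite A" "\<And>a. a \<in> A \<Longrightarrow> -1 \<le> a \<and> a \<le> 1 \<and> 0 \<le> w a"
    and exact: "\<And>p. degree p < 2 * n \<Longrightarrow> poly_int p = (\<Sum>a\<in>A. w a * poly p a)"
    and M: "\<And>x. x \<in> {-1..1} \<Longrightarrow> \<bar>poly ((pderiv ^^ s) p) x\<bar> \<le> M"
  shows "(poly_int p - (\<Sum>a\<in>A. w a * poly p a))\<^sup>2 \<le>
     8 * (71/63)\<^sup>2 * M\<^sup>2 * sin_mean s * (real (2 * n) + real s) / ((2 * real s - 1) * cheb_eig s (2 * n))"
proof -
  define R where "R = (\<lambda>p. poly_int p - (\<Sum>a\<in>A. w a * poly p a))"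
  let ?N = "2 * n"
  have R_sum: "R (\<Sum>k\<in>I. smult (c k) (q k)) = (\<Sum>k\<in>I. c k * R (q k))" for I :: "nat set" and c q
    unfolding R_def poly_int_sum poly_int_smult
    by (simp add: poly_sum right_diff_distrib sum_subtractf sum_distrib_left sum.swap[of _ A] mult_ac)
  have wsum: "(\<Sum>a\<in>A. w a) = 2"
    using exact[of 1] n poly_int_pderiv[of "[:0, 1:]"] by (simp add: pderiv_pCons one_pCons)
  have R0: "R (cheb k) = 0" if "k < ?N" for k
    using exact[of "cheb k"] degree_cheb_le[of k] that by (simp add: R_def)
  have R1: "\<bar>R (cheb k)\<bar> \<le> 2 * (71/63)" if k: "?N \<le> k" for k
  proof -
    have k8: "real k \<ge> 8" using k n by simp
    have "\<bar>\<Sum>a\<in>A. w a * poly (cheb k) a\<bar> \<le> (\<Sum>a\<in>A. w a * 1)"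
      using A(2) abs_poly_cheb_le_1[of _ k]
      by (intro order.trans[OF sum_abs] sum_mono) (auto simp: abs_mult intro!: mult_left_le)
    then have "\<bar>\<Sum>a\<in>A. w a * poly (cheb k) a\<bar> \<le> 2" using wsum by simp
    moreover have "2 * real k / ((real k)\<^sup>2 - 1) \<le> 2 * (8 / 63)"
    proof -
      have sq: "8 * real k \<le> (real k)\<^sup>2" using k8 by (simp add: power2_eq_square)
      then have "63 * real k \<le> 8 * ((real k)\<^sup>2 - 1)" using k8 by (simp add: right_diff_distrib)
      moreover have "(real k)\<^sup>2 - 1 > 0" using k8 sq by linarith
      ultimately show ?thesis by (simp add: divide_simps)
    qed
    ultimately show ?thesis
      using abs_poly_int_cheb_le[of k] k n unfolding R_def by linarith
  qed
  define K where "K = degree p"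
  obtain c where c: "p = (\<Sum>k\<le>K. smult (c k) (cheb k))"
    using cheb_expansion[of p K] by (auto simp: K_def)
  have pos: "cheb_eig s k > 0" if "?N \<le> k" for k
    using that s n by (intro cheb_eig_pos) auto
  have "R p = (\<Sum>k\<le>K. c k * R (cheb k))" by (subst c) (rule R_sum)
  also have "\<dots> = (\<Sum>k\<in>{?N..K}. c k * R (cheb k))"
    by (rule sum.mono_neutral_right) (auto simp: R0)
  also have "\<dots> = (\<Sum>k\<in>{?N..K}. (c k * sqrt (cheb_eig s k)) * (R (cheb k) / sqrt (cheb_eig s k)))"
    using pos by (intro sum.cong) (auto simp: less_imp_neq[symmetric])
  finally have "(R p)\<^sup>2 \<le> (\<Sum>k\<in>{?N..K}. (c k * sqrt (cheb_eig s k))\<^sup>2) * (\<Sum>k\<in>{?N..K}. (R (cheb k) / sqrt (cheb_eig s k))\<^sup>2)"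
    by (simp only: Cauchy_Schwarz_ineq_sum)
  also have "\<dots> \<le> (2 * M\<^sup>2 * sin_mean s) * ((2 * (71/63))\<^sup>2 * ((real ?N + real s) / ((2 * real s - 1) * cheb_eig s ?N)))"
  proof (rule mult_mono)
    have "(\<Sum>k\<in>{?N..K}. (c k * sqrt (cheb_eig s k))\<^sup>2) = (\<Sum>k\<in>{?N..K}. (c k)\<^sup>2 * cheb_eig s k)"
      using pos by (intro sum.cong) (auto simp: power_mult_distrib less_imp_le)
    also have "\<dots> \<le> (\<Sum>k\<in>{1..K}. (c k)\<^sup>2 * cheb_eig s k)"
    proof (rule sum_mono2)
      fix k assume k: "k \<in> {1..K} - {?N..K}"
      have "cheb_eig s k \<ge> 0"
      proof (cases "s \<le> k")
        case True
        then show ?thesis using k cheb_eig_pos[of s k] by auto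
      next
        case False
        then have "cheb_eig s k = 0"
          unfolding cheb_eig_def by (intro prod_zero) (auto intro!: bexI[of _ k])
        then show ?thesis by simp
      qed
      then show "0 \<le> (c k)\<^sup>2 * cheb_eig s k" by simp
    qed (use n in auto)
    also have "\<dots> \<le> 2 * M\<^sup>2 * sin_mean s"
      by (rule cheb_coeffs_weighted_bound[OF c s(1) M])
    finally show "(\<Sum>k\<in>{?N..K}. (c k * sqrt (cheb_eig s k))\<^sup>2) \<le> 2 * M\<^sup>2 * sin_mean s" .
    have "(\<Sum>k\<in>{?N..K}. (R (cheb k) / sqrt (cheb_eig s k))\<^sup>2) \<le> (\<Sum>k\<in>{?N..K}. (2 * (71/63))\<^sup>2 * (1 / cheb_eig s k))"
    proof (rule sum_mono)
      fix k assume k: "k \<in> {?N..K}"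
      have "(R (cheb k))\<^sup>2 = \<bar>R (cheb k)\<bar>\<^sup>2" by simp
      also have "\<dots> \<le> (2 * (71/63))\<^sup>2" using k R1 by (intro power_mono) auto
      finally have "(R (cheb k))\<^sup>2 * (1 / cheb_eig s k) \<le> (2 * (71/63))\<^sup>2 * (1 / cheb_eig s k)"
        using pos[of k] k by (intro mult_right_mono) auto
      then show "(R (cheb k) / sqrt (cheb_eig s k))\<^sup>2 \<le> (2 * (71/63))\<^sup>2 * (1 / cheb_eig s k)"
        using pos[of k] k by (simp add: power_divide)
    qed
    also have "\<dots> \<le> (2 * (71/63))\<^sup>2 * ((real ?N + real s) / ((2 * real s - 1) * cheb_eig s ?N))"
      unfolding sum_distrib_left[symmetric] using s
      by (intro mult_left_mono sum_inverse_cheb_eig_le) auto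
    finally show "(\<Sum>k\<in>{?N..K}. (R (cheb k) / sqrt (cheb_eig s k))\<^sup>2) \<le>
       (2 * (71/63))\<^sup>2 * ((real ?N + real s) / ((2 * real s - 1) * cheb_eig s ?N))" .
  qed (auto simp: sin_mean_def intro!: mult_nonneg_nonneg sum_nonneg prod_nonneg)
  finally show ?thesis unfolding R_def by (simp add: power2_eq_square mult_ac)
qed

section \<open>The constant of the Gauss rule\<close>

lemma ln_le_half_diff_inverse:
  fixes y :: real
  assumes "y \<ge> 1"
  shows "ln y \<le> (y - 1 / y) / 2"
proof -
  let ?h = "\<lambda>y::real. (y - 1 / y) / 2 - ln y"
  have "?h 1 \<le> ?h y"
  proof (rule DERIV_nonneg_imp_nondecreasing[OF assms])
    fix x :: real assume "1 \<le> x" "x \<le> y"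
    then have "(?h has_real_derivative (1 - 1 / x)\<^sup>2 / 2) (at x)"
      by (auto intro!: derivative_eq_intros simp: field_simps power2_eq_square)
    then show "\<exists>d. (?h has_real_derivative d) (at x) \<and> 0 \<le> d" by fastforce
  qed
  then show ?thesis by simp
qed

text \<open>
  The plain bound \<open>exp 1 ^ 2\<close> would not do: in the induction below the gain of \<open>1 / m\<close> in the last factor
  pays for terms of the same order.
\<close>
lemma one_plus_inverse_power_le:
  assumes m: "m \<ge> 1"
  shows "((real m + 1) / real m) ^ (2 * m) \<le> (exp 1)\<^sup>2 * ((real m + 1) / (real m + 2))"
proof -
  let ?y = "(real m + 1) / real m"
  have y: "?y \<ge> 1" using m by simp
  have "real (2 * m) * ln ?y \<le> real (2 * m) * ((?y - 1 / ?y) / 2)"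
    using ln_le_half_diff_inverse[OF y] by (intro mult_left_mono) auto
  also have "\<dots> = 2 - 1 / (real m + 1)"
  proof -
    have "?y - 1 / ?y = (2 * real m + 1) / (real m * (real m + 1))"
      using m by (simp add: divide_simps) (simp add: algebra_simps)
    then have "real (2 * m) * ((?y - 1 / ?y) / 2) = (2 * real m + 1) / (real m + 1)"
      using m by simp
    then show ?thesis by (simp add: divide_simps)
  qed
  finally have "?y ^ (2 * m) \<le> exp (2 - 1 / (real m + 1))"
    using y m by (metis exp_le_cancel_iff exp_ln exp_of_nat_mult less_le_trans zero_less_one)
  also have "\<dots> = (exp 1)\<^sup>2 / exp (1 / (real m + 1))"
    by (simp add: exp_diff exp_double[symmetric] flip: exp_of_nat_mult)
  also have "\<dots> \<le> (exp 1)\<^sup>2 / (1 + 1 / (real m + 1))"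
    using exp_ge_add_one_self[of "1 / (real m + 1)"]
    by (intro divide_left_mono) (auto intro!: mult_pos_pos add_pos_nonneg)
  also have "\<dots> = (exp 1)\<^sup>2 * ((real m + 1) / (real m + 2))"
    by (simp add: field_simps)
  finally show ?thesis .
qed

lemma exp_1_ge: "exp 1 \<ge> (2.7::real)"
  using e_approx_32 by (simp add: abs_if split: if_split_asm)

text \<open>
  The product of \<open>1 / (1 - (j / k)\<^sup>2)\<close> over \<open>j < s\<close>.
\<close>
definition eig_ratio :: "nat \<Rightarrow> nat \<Rightarrow> real" where
  "eig_ratio s k = real k ^ (2 * s) / cheb_eig s k"

text \<open>
  Two shifts lead from index \<open>2 s + 2\<close> to \<open>2 s + 4\<close>, and the step from \<open>s\<close> to \<open>s + 1\<close> adds one factor.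
\<close>
lemma cheb_eig_diagonal_Suc:
  "cheb_eig (Suc s) (2 * s + 4) * (real s + 3) =
   cheb_eig s (2 * s + 2) * (3 * (real s + 2) * (9 * (real s + 1)\<^sup>2 - 1))"
proof -
  define m where "m = real s + 1"
  define a0 a1 a2 where "a0 = cheb_eig s (2 * s + 2)" and "a1 = cheb_eig s (Suc (2 * s + 2))"
    and "a2 = cheb_eig s (Suc (Suc (2 * s + 2)))"
  have m: "m \<ge> 1" by (simp add: m_def)
  have 1: "a1 * (2 * m * (m + 2)) = a0 * ((2 * m + 1) * (3 * m - 1))"
    using cheb_eig_shift[of s "2 * s + 2"] by (simp add: a0_def a1_def m_def algebra_simps)
  have 2: "a2 * ((2 * m + 1) * (m + 3)) = a1 * ((2 * m + 2) * (3 * m))"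
    using cheb_eig_shift[of s "Suc (2 * s + 2)"] by (simp add: a2_def a1_def m_def algebra_simps)
  have 3: "cheb_eig (Suc s) (2 * s + 4) = a2 * ((m + 3) * (3 * m + 1))"
    by (simp add: cheb_eig_def a2_def m_def power2_eq_square algebra_simps eval_nat_numeral)
  have "cheb_eig (Suc s) (2 * s + 4) * (m + 2) * (2 * m * (2 * m + 1))
      = a2 * ((2 * m + 1) * (m + 3)) * (3 * m + 1) * (2 * m * (m + 2))"
    unfolding 3 by (simp only: mult_ac)
  also have "\<dots> = a1 * (2 * m * (m + 2)) * ((2 * m + 2) * (3 * m)) * (3 * m + 1)"
    unfolding 2 by (simp only: mult_ac)
  also have "\<dots> = a0 * (3 * (m + 1) * (9 * m\<^sup>2 - 1)) * (2 * m * (2 * m + 1))"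
    unfolding 1 by (simp add: algebra_simps power2_eq_square)
  finally have "cheb_eig (Suc s) (2 * s + 4) * (m + 2) = a0 * (3 * (m + 1) * (9 * m\<^sup>2 - 1))"
    using m by simp
  then show ?thesis by (simp add: a0_def m_def algebra_simps)
qed

lemma eig_ratio_antimono:
  assumes "s \<le> k" "k \<le> l" "k \<ge> 1"
  shows "eig_ratio s l \<le> eig_ratio s k"
proof -
  have eq: "eig_ratio s k = (\<Prod>j<s. (real k)\<^sup>2 / ((real k)\<^sup>2 - (real j)\<^sup>2))" for k
    by (simp add: eig_ratio_def cheb_eig_def prod_dividef power_mult)
  show ?thesis
    unfolding eq
  proof (rule prod_mono)
    fix j assume j: "j \<in> {..<s}"
    have aux: "0 \<le> L / (L - J) \<and> L / (L - J) \<le> K / (K - J)"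
      if "0 \<le> J" "J < K" "K \<le> L" for J K L :: real
    proof -
      have "K * J \<le> L * J" using that by (intro mult_right_mono) auto
      then show ?thesis using that by (auto simp: divide_simps algebra_simps)
    qed
    show "0 \<le> (real l)\<^sup>2 / ((real l)\<^sup>2 - (real j)\<^sup>2) \<and>
       (real l)\<^sup>2 / ((real l)\<^sup>2 - (real j)\<^sup>2) \<le> (real k)\<^sup>2 / ((real k)\<^sup>2 - (real j)\<^sup>2)"
      using assms j by (intro aux) (auto intro!: power_strict_mono)
  qed
qed

text \<open>
  This is where \<open>exp 1 / (6 * sqrt 3)\<close> comes from. For \<open>k = 2 s + 2\<close> the product \<open>cheb_eig s k\<close> grows like
  \<open>(3 s)! / s!\<close> up to powers of \<open>s\<close>, so \<open>eig_ratio s k\<close> grows like the \<open>s\<close>-th power of \<open>4 (exp 1)\<^sup>2 / 27\<close>, which is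
  \<open>16 (exp 1 / (6 * sqrt 3))\<^sup>2\<close>. In the induction the quotient of consecutive left-hand sides stays
  below this number thanks to the factor \<open>(2 m - 1) / (2 m)\<close> from \<open>sin_mean\<close>. At \<open>s = 2\<close> the inequality
  fails, so the induction starts at 3.
\<close>
lemma gauss_const_diagonal_bound:
  assumes "s \<ge> 3"
  shows "2 * (71/63)\<^sup>2 * (sin_mean s * ((5 * real s + 2) / (2 * real s - 1)) * eig_ratio s (2 * s + 2))
     \<le> pi\<^sup>2 / 4 * (4 * (exp 1)\<^sup>2 / 27) ^ s"
  using assms
proof (induction s rule: nat_induct_at_least)
  case base
  (* The two sides are about 2.93 and at least 3.02. *)
  have er: "eig_ratio 3 8 = 4096 / 3780"
    by (simp add: eig_ratio_def cheb_eig_def eval_nat_numeral)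
  have sm: "sin_mean 3 = 15 / 48"
    by (simp add: sin_mean_def eval_nat_numeral)
  have L: "2 * (71/63)\<^sup>2 * (sin_mean 3 * ((5 * 3 + 2) / (2 * 3 - 1)) * eig_ratio 3 8) \<le> 2.95"
    unfolding er sm by (simp add: power2_eq_square)
  have "(3.1::real) ^ 2 / 4 * (4 * 2.7 ^ 2 / 27) ^ 3 \<le> pi\<^sup>2 / 4 * (4 * (exp 1)\<^sup>2 / 27) ^ 3"
    using exp_1_ge pi_approx(1) by (intro mult_mono divide_right_mono power_mono mult_left_mono) auto
  moreover have "(2.95::real) \<le> 3.1 ^ 2 / 4 * (4 * 2.7 ^ 2 / 27) ^ 3"
    by (simp add: power2_eq_square power3_eq_cube)
  ultimately show ?case using L by (simp add: mult_ac)
next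
  case (Suc s)
  define m where "m = real (Suc s)"
  have m: "m \<ge> 4" "real s = m - 1" using Suc by (auto simp: m_def)
  have pos: "cheb_eig s (2 * s + 2) > 0" "cheb_eig (Suc s) (2 * s + 4) > 0"
    by (intro cheb_eig_pos; simp)+
  have m9: "9 * m\<^sup>2 - 1 > 0" using m(1) by (simp add: power2_eq_square) (use mult_mono[of 4 m 4 m] in auto)
  have eig: "eig_ratio (Suc s) (2 * Suc s + 2) =
      eig_ratio s (2 * s + 2) * (4 * ((m + 1) / m) ^ (2 * Suc s) * m\<^sup>2 * (m + 2) / (3 * (m + 1) * (9 * m\<^sup>2 - 1)))"
  proof -
    have E: "cheb_eig (Suc s) (2 * s + 4) = cheb_eig s (2 * s + 2) * (3 * (m + 1) * (9 * m\<^sup>2 - 1)) / (m + 2)"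
      using cheb_eig_diagonal_Suc[of s] m by (simp add: field_simps)
    have "real (2 * s + 4) ^ (2 * Suc s) = (2 * m) ^ (2 * Suc s) * ((m + 1) / m) ^ (2 * Suc s)"
    proof -
      have "real (2 * s + 4) = 2 * m * ((m + 1) / m)" using m by simp
      then show ?thesis by (simp only: power_mult_distrib)
    qed
    also have "(2 * m) ^ (2 * Suc s) = real (2 * s + 2) ^ (2 * s) * (4 * m\<^sup>2)"
    proof -
      have "real (2 * s + 2) = 2 * m" using m by simp
      then show ?thesis by (simp only:) (simp add: power2_eq_square)
    qed
    finally have pw: "real (2 * s + 4) ^ (2 * Suc s) =
      real (2 * s + 2) ^ (2 * s) * (4 * m\<^sup>2) * ((m + 1) / m) ^ (2 * Suc s)" .
    have idx: "2 * Suc s + 2 = 2 * s + 4" by simp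
    show ?thesis
      unfolding eig_ratio_def idx E pw
      by (simp only: times_divide_eq_left times_divide_eq_right divide_divide_eq_right
          divide_divide_eq_left mult_ac)
  qed
  have "((m + 1) / m) ^ (2 * Suc s) \<le> (exp 1)\<^sup>2 * ((m + 1) / (m + 2))"
    using one_plus_inverse_power_le[of "Suc s"] by (simp add: m_def add_ac)
  then have "(2 * m - 1) / (2 * m) * (4 * ((m + 1) / m) ^ (2 * Suc s) * m\<^sup>2 * (m + 2) / (3 * (m + 1) * (9 * m\<^sup>2 - 1)))
     \<le> (2 * m - 1) / (2 * m) * (4 * ((exp 1)\<^sup>2 * ((m + 1) / (m + 2))) * m\<^sup>2 * (m + 2) / (3 * (m + 1) * (9 * m\<^sup>2 - 1)))"
    using m m9 by (intro mult_left_mono divide_right_mono mult_right_mono) auto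
  also have "\<dots> = (exp 1)\<^sup>2 * (2 * (2 * m\<^sup>2 - m) / (3 * (9 * m\<^sup>2 - 1)))"
    using m m9 by (simp add: divide_simps) (simp add: algebra_simps power2_eq_square)
  also have "\<dots> \<le> (exp 1)\<^sup>2 * (4 / 27)"
    using m m9 by (intro mult_left_mono) (auto simp: divide_simps)
  finally have ratio: "(2 * m - 1) / (2 * m) * (4 * ((m + 1) / m) ^ (2 * Suc s) * m\<^sup>2 * (m + 2) / (3 * (m + 1) * (9 * m\<^sup>2 - 1)))
     \<le> 4 * (exp 1)\<^sup>2 / 27" by simp
  have sm: "sin_mean (Suc s) = sin_mean s * ((2 * m - 1) / (2 * m))"
    using m by (simp add: sin_mean_def)
  have lin: "(5 * real (Suc s) + 2) / (2 * real (Suc s) - 1) \<le> (5 * real s + 2) / (2 * real s - 1)"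
    using Suc.hyps by (simp add: divide_simps) (simp add: algebra_simps)
  have nn: "sin_mean s \<ge> 0" "eig_ratio s (2 * s + 2) \<ge> 0"
    using pos by (auto simp: sin_mean_def eig_ratio_def intro!: prod_nonneg)
  let ?q = "(2 * m - 1) / (2 * m) * (4 * ((m + 1) / m) ^ (2 * Suc s) * m\<^sup>2 * (m + 2) / (3 * (m + 1) * (9 * m\<^sup>2 - 1)))"
  let ?Y = "\<lambda>s. sin_mean s * ((5 * real s + 2) / (2 * real s - 1)) * eig_ratio s (2 * s + 2)"
  have "?Y (Suc s) = (sin_mean s * eig_ratio s (2 * s + 2)) * ((5 * real (Suc s) + 2) / (2 * real (Suc s) - 1)) * ?q"
    unfolding eig sm by (simp only: mult_ac)
  also have "\<dots> \<le> (sin_mean s * eig_ratio s (2 * s + 2)) * ((5 * real s + 2) / (2 * real s - 1)) * (4 * (exp 1)\<^sup>2 / 27)"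
    using nn lin ratio m m9 Suc.hyps by (intro mult_mono) auto
  also have "\<dots> = ?Y s * (4 * (exp 1)\<^sup>2 / 27)" by (simp only: mult_ac)
  finally have "2 * (71/63)\<^sup>2 * ?Y (Suc s) \<le> 2 * (71/63)\<^sup>2 * (?Y s * (4 * (exp 1)\<^sup>2 / 27))"
    by (rule mult_left_mono) simp
  also have "\<dots> = 2 * (71/63)\<^sup>2 * ?Y s * (4 * (exp 1)\<^sup>2 / 27)"
    by (simp only: mult.assoc)
  also have "\<dots> \<le> pi\<^sup>2 / 4 * (4 * (exp 1)\<^sup>2 / 27) ^ s * (4 * (exp 1)\<^sup>2 / 27)"
    by (intro mult_right_mono Suc.IH) auto
  finally show ?case by (simp only: power_Suc mult_ac)
qed

definition rule_const :: "nat \<Rightarrow> real" where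
  "rule_const s = pi / 2 * (exp 1 / (6 * sqrt 3)) ^ s"

text \<open>
  Of the two factors depending on \<open>n\<close>, \<open>eig_ratio s (2 n)\<close> is largest at \<open>n = s + 1\<close> and \<open>2 n + s\<close> at
  \<open>n = 2 s + 1\<close>. Estimating them separately reduces the claim to \<open>gauss_const_diagonal_bound\<close>.
\<close>
lemma gauss_const_bound:
  assumes s: "s \<ge> 3" and n: "s + 1 \<le> n" "n \<le> 2 * s + 1"
  shows "8 * (71/63)\<^sup>2 * sin_mean s * (real (2 * n) + real s) / ((2 * real s - 1) * cheb_eig s (2 * n))
     \<le> (2 * (2 ^ s * rule_const s / real n ^ s))\<^sup>2"
proof -
  have pos: "cheb_eig s (2 * n) > 0" using n by (intro cheb_eig_pos) auto
  have nn: "sin_mean s \<ge> 0" by (auto simp: sin_mean_def intro!: prod_nonneg)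
  have er: "1 / cheb_eig s (2 * n) = eig_ratio s (2 * n) / (4 ^ s * real n ^ (2 * s))"
    using n by (simp add: eig_ratio_def power_mult_distrib power_mult)
  have "8 * (71/63)\<^sup>2 * sin_mean s * (real (2 * n) + real s) / ((2 * real s - 1) * cheb_eig s (2 * n))
     = 8 * (71/63)\<^sup>2 * sin_mean s * ((real (2 * n) + real s) / (2 * real s - 1)) * (1 / cheb_eig s (2 * n))"
    by simp
  also have "\<dots> \<le> 8 * (71/63)\<^sup>2 * sin_mean s * ((5 * real s + 2) / (2 * real s - 1)) * (eig_ratio s (2 * s + 2) / (4 ^ s * real n ^ (2 * s)))"
    unfolding er using s n nn
    by (intro mult_mono mult_left_mono divide_right_mono eig_ratio_antimono mult_nonneg_nonneg)
       (use pos in \<open>auto simp: eig_ratio_def\<close>)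
  also have "\<dots> = 4 * (2 * (71/63)\<^sup>2 * (sin_mean s * ((5 * real s + 2) / (2 * real s - 1)) * eig_ratio s (2 * s + 2)))
       / (4 ^ s * real n ^ (2 * s))"
    by simp
  also have "\<dots> \<le> 4 * (pi\<^sup>2 / 4 * (4 * (exp 1)\<^sup>2 / 27) ^ s) / (4 ^ s * real n ^ (2 * s))"
    by (intro divide_right_mono mult_left_mono gauss_const_diagonal_bound s) auto
  also have "\<dots> = (2 * (2 ^ s * rule_const s / real n ^ s))\<^sup>2"
  proof -
    have "(rule_const s)\<^sup>2 = pi\<^sup>2 / 4 * ((exp 1)\<^sup>2 / 108) ^ s"
    proof -
      have "((exp 1 / (6 * sqrt 3)) ^ s)\<^sup>2 = ((exp 1 / (6 * sqrt 3))\<^sup>2) ^ s"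
        by (simp add: power_mult[symmetric] mult.commute)
      also have "(exp 1 / (6 * sqrt 3))\<^sup>2 = (exp 1)\<^sup>2 / 108"
        by (simp add: power_divide power_mult_distrib)
      finally have sq: "((exp 1 / (6 * sqrt 3)) ^ s)\<^sup>2 = ((exp 1)\<^sup>2 / 108 :: real) ^ s" .
      show ?thesis
        unfolding rule_const_def power_mult_distrib sq by (simp add: power_divide)
    qed
    moreover have "((2::real) ^ s)\<^sup>2 = 4 ^ s"
      by (simp add: power2_eq_square flip: power_mult_distrib)
    moreover have "(2 * (2 ^ s * rule_const s / real n ^ s))\<^sup>2 =
        4 * ((2 ^ s)\<^sup>2 * (rule_const s)\<^sup>2 / real n ^ (2 * s))"
      by (simp add: power_mult_distrib power_divide power_even_eq)
    ultimately have "(2 * (2 ^ s * rule_const s / real n ^ s))\<^sup>2 =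
        4 * (pi\<^sup>2 / 4 * (4 ^ s * ((exp 1)\<^sup>2 / 108) ^ s) / real n ^ (2 * s))"
      by simp
    also have "4 ^ s * ((exp 1)\<^sup>2 / 108 :: real) ^ s = (4 * (exp 1)\<^sup>2 / 27) ^ s / 4 ^ s"
      by (simp add: power_divide[symmetric] power_mult_distrib[symmetric])
    finally show ?thesis by simp
  qed
  finally show ?thesis .
qed

section \<open>From polynomials to differentiable functions\<close>

lemma antiderivative_poly: "\<exists>q. pderiv q = (p :: real poly)"
proof -
  let ?q = "\<Sum>i\<le>degree p. monom (coeff p i / real (Suc i)) (Suc i)"
  have ps: "pderiv (sum f A) = (\<Sum>i\<in>A. pderiv (f i))" for f :: "nat \<Rightarrow> real poly" and A
    using higher_pderiv_sum[of 1 f A] by simp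
  have "pderiv ?q = (\<Sum>i\<le>degree p. monom (coeff p i) i)"
    unfolding ps by (simp add: pderiv_monom del: of_nat_Suc)
  then show ?thesis by (metis poly_as_sum_of_monoms)
qed

lemma deriv_bound_Suc_E:
  assumes "deriv_bound (Suc s) M a b f"
  obtains f' where "deriv_bound s M a b f'"
    "\<And>t. t \<in> {a..b} \<Longrightarrow> (f has_real_derivative f' t) (at t within {a..b})"
proof -
  obtain g where g: "g 0 = f"
    "\<forall>k<Suc s. \<forall>t\<in>{a..b}. (g k has_real_derivative g (Suc k) t) (at t within {a..b})"
    "continuous_on {a..b} (g (Suc s))" "\<forall>t\<in>{a..b}. \<bar>g (Suc s) t\<bar> \<le> M"
    using assms unfolding deriv_bound_def by blast
  have "deriv_bound s M a b (g 1)"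
    unfolding deriv_bound_def using g by (intro exI[of _ "\<lambda>k. g (Suc k)"]) auto
  moreover have "(f has_real_derivative g 1 t) (at t within {a..b})" if "t \<in> {a..b}" for t
    using g(1,2) that by auto
  ultimately show thesis using that by blast
qed

text \<open>
  Approximate the highest derivative by Weierstrass' theorem and integrate \<open>s\<close> times, matching the value
  at \<open>-1\<close>. The interval has length 2, so halving \<open>\<delta>\<close> in every step compensates each integration.
\<close>
lemma polynomial_approximation:
  assumes "deriv_bound s M (-1) 1 f" "\<delta> > 0"
  shows "\<exists>p. (\<forall>x\<in>{-1..1}. \<bar>poly p x - f x\<bar> \<le> \<delta> \<and> \<bar>poly ((pderiv ^^ s) p) x\<bar> \<le> M + \<delta>)"
  using assms
proof (induction s arbitrary: f \<delta>)
  case 0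
  then have c: "continuous_on {-1..1} f" and M: "\<And>x. x \<in> {-1..1} \<Longrightarrow> \<bar>f x\<bar> \<le> M"
    by (auto simp: deriv_bound_def)
  obtain g where g: "real_polynomial_function g" "\<And>x. x \<in> {-1..1} \<Longrightarrow> \<bar>f x - g x\<bar> < \<delta>"
    using Stone_Weierstrass_real_polynomial_function[OF compact_Icc c] 0 by metis
  then obtain a n where an: "g = (\<lambda>x. \<Sum>i\<le>n. a i * x ^ i)"
    by (auto simp: real_polynomial_function_iff_sum)
  have "poly (\<Sum>i\<le>n. monom (a i) i) x = g x" for x
    by (simp add: an poly_sum poly_monom)
  then show ?case
    using g(2) M by (intro exI[of _ "\<Sum>i\<le>n. monom (a i) i"]) (fastforce simp: abs_le_iff abs_less_iff)
next
  case (Suc s)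
  obtain f' where f': "deriv_bound s M (-1) 1 f'"
    "\<And>t. t \<in> {-1..1} \<Longrightarrow> (f has_real_derivative f' t) (at t within {-1..1})"
    using deriv_bound_Suc_E[OF Suc.prems(1)] by blast
  obtain p' where p': "\<And>x. x \<in> {-1..1} \<Longrightarrow> \<bar>poly p' x - f' x\<bar> \<le> \<delta> / 2 \<and> \<bar>poly ((pderiv ^^ s) p') x\<bar> \<le> M + \<delta> / 2"
    using Suc.IH[OF f'(1), of "\<delta> / 2"] Suc.prems(2) by (meson half_gt_zero)
  obtain q where q: "pderiv q = p'" using antiderivative_poly by blast
  define p where "p = q + [:f (-1) - poly q (-1):]"
  have pd: "pderiv p = p'" by (simp add: p_def pderiv_add q)
  have "\<bar>poly p x - f x\<bar> \<le> \<delta>" if x: "x \<in> {-1..1}" for x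
  proof -
    have "norm ((poly p x - f x) - (poly p (-1) - f (-1))) \<le> \<delta> / 2 * norm (x - (-1))"
    proof (rule field_differentiable_bound[of "{-1..1}" "\<lambda>x. poly p x - f x" "\<lambda>x. poly p' x - f' x"])
      fix z :: real assume z: "z \<in> {-1..1}"
      show "((\<lambda>x. poly p x - f x) has_real_derivative poly p' z - f' z) (at z within {-1..1})"
        by (intro DERIV_diff f'(2) z has_field_derivative_at_within[OF poly_DERIV[of p z, unfolded pd]])
    qed (use x p' in auto)
    also have "\<dots> \<le> \<delta> / 2 * 2" using x Suc.prems(2) by (intro mult_left_mono) auto
    finally show ?thesis by (simp add: p_def)
  qed
  moreover have "(pderiv ^^ Suc s) p = (pderiv ^^ s) p'"
    by (simp only: funpow_Suc_right o_apply pd)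
  ultimately show ?case
    using p' Suc.prems(2) by (intro exI[of _ p]) fastforce
qed

text \<open>
  When \<open>f\<close> is replaced by a polynomial within \<open>\<delta>\<close>, the integral and the rule change by at most \<open>2 \<delta>\<close>
  each, because 2 is both the length of the interval and the sum of the nonnegative weights.
\<close>
lemma quadrature_error_from_polys:
  assumes A: "finite A" "\<And>a. a \<in> A \<Longrightarrow> -1 \<le> a \<and> a \<le> 1 \<and> 0 \<le> w a" and w2: "(\<Sum>a\<in>A. w a) = 2"
    and polys: "\<And>p M. (\<And>x. x \<in> {-1..1} \<Longrightarrow> \<bar>poly ((pderiv ^^ s) p) x\<bar> \<le> M) \<Longrightarrow>
        \<bar>poly_int p - (\<Sum>a\<in>A. w a * poly p a)\<bar> \<le> C * M" and C: "C \<ge> 0"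
    and f: "deriv_bound s M (-1) 1 f"
  shows "\<bar>integral {-1..1} f - (\<Sum>a\<in>A. w a * f a)\<bar> \<le> C * M"
proof (rule field_le_epsilon)
  fix e :: real assume e: "e > 0"
  define \<delta> where "\<delta> = e / (C + 4)"
  have \<delta>: "\<delta> > 0" "\<delta> * (C + 4) = e" using e C by (auto simp: \<delta>_def)
  obtain p where p: "\<And>x. x \<in> {-1..1} \<Longrightarrow> \<bar>poly p x - f x\<bar> \<le> \<delta>"
      "\<And>x. x \<in> {-1..1} \<Longrightarrow> \<bar>poly ((pderiv ^^ s) p) x\<bar> \<le> M + \<delta>"
    using polynomial_approximation[OF f \<delta>(1)] by blast
  have c: "continuous_on {-1..1} f" by (rule deriv_bound_continuous[OF f])
  have "((\<lambda>x. poly p x - f x) has_integral (poly_int p - integral {-1..1} f)) {-1..1}"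
    unfolding poly_int_def
    by (intro has_integral_diff integrable_integral integrable_poly integrable_continuous_real c)
  from has_integral_bound_real[OF _ finite.emptyI this, of \<delta>] \<delta>(1) p(1)
  have 1: "\<bar>poly_int p - integral {-1..1} f\<bar> \<le> 2 * \<delta>"
    by simp
  have "\<bar>\<Sum>a\<in>A. w a * (poly p a - f a)\<bar> \<le> (\<Sum>a\<in>A. w a * \<delta>)"
    using A(2) p(1) by (intro order.trans[OF sum_abs] sum_mono) (auto simp: abs_mult intro!: mult_mono)
  also have "\<dots> = 2 * \<delta>" using w2 by (simp add: sum_distrib_right[symmetric])
  finally have 2: "\<bar>(\<Sum>a\<in>A. w a * poly p a) - (\<Sum>a\<in>A. w a * f a)\<bar> \<le> 2 * \<delta>"
    by (simp add: right_diff_distrib sum_subtractf)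
  have "\<bar>integral {-1..1} f - (\<Sum>a\<in>A. w a * f a)\<bar> \<le> C * (M + \<delta>) + 4 * \<delta>"
    using polys[OF p(2)] 1 2 by linarith
  also have "\<dots> = C * M + e" using \<delta>(2) by (simp add: algebra_simps)
  finally show "\<bar>integral {-1..1} f - (\<Sum>a\<in>A. w a * f a)\<bar> \<le> C * M + e" .
qed

lemma rule_const_pos: "rule_const s > 0"
  by (simp add: rule_const_def)

text \<open>
  Moving the Gauss rule from \<open>[-1, 1]\<close> to \<open>[0, 1]\<close> halves the weights and multiplies the \<open>s\<close>-th derivative
  by \<open>(1/2) ^ s\<close>; the constant \<open>C\<close> is the one on \<open>[-1, 1]\<close>.
\<close>
lemma Gauss_has_rule:
  assumes s: "s \<ge> 3" and n: "s + 1 \<le> n" "n \<le> 2 * s + 1"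
  shows "has_rule s (rule_const s) n"
proof -
  obtain A w where A: "finite A" "card A = n" "\<And>a. a \<in> A \<Longrightarrow> -1 < a \<and> a < 1 \<and> 0 \<le> w a"
    and exact: "\<And>p. degree p < 2 * n \<Longrightarrow> poly_int p = (\<Sum>a\<in>A. w a * poly p a)"
    using Gauss_quadrature[of n] n by auto
  have w2: "(\<Sum>a\<in>A. w a) = 2"
    using exact[of 1] n poly_int_pderiv[of "[:0, 1:]"] by (simp add: pderiv_pCons one_pCons)
  define C where "C = 2 * (2 ^ s * rule_const s / real n ^ s)"
  have C: "C \<ge> 0" using rule_const_pos[of s] by (simp add: C_def)
  have polys: "\<bar>poly_int p - (\<Sum>a\<in>A. w a * poly p a)\<bar> \<le> C * M"
    if M: "\<And>x. x \<in> {-1..1} \<Longrightarrow> \<bar>poly ((pderiv ^^ s) p) x\<bar> \<le> M" for p M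
  proof -
    have M0: "M \<ge> 0" using M[of 0] by auto
    have "(poly_int p - (\<Sum>a\<in>A. w a * poly p a))\<^sup>2 \<le>
      8 * (71/63)\<^sup>2 * M\<^sup>2 * sin_mean s * (real (2 * n) + real s) / ((2 * real s - 1) * cheb_eig s (2 * n))"
      by (rule Gauss_poly_error[OF _ _ _ A(1) _ exact M]) (use s n A(3) in \<open>auto intro: less_imp_le\<close>)
    also have "\<dots> = 8 * (71/63)\<^sup>2 * sin_mean s * (real (2 * n) + real s) / ((2 * real s - 1) * cheb_eig s (2 * n)) * M\<^sup>2"
      by simp
    also have "\<dots> \<le> C\<^sup>2 * M\<^sup>2"
      unfolding C_def by (intro mult_right_mono gauss_const_bound s n) auto
    finally have "\<bar>poly_int p - (\<Sum>a\<in>A. w a * poly p a)\<bar>\<^sup>2 \<le> (C * M)\<^sup>2"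
      by (simp add: power_mult_distrib)
    then show ?thesis by (rule power2_le_imp_le) (intro mult_nonneg_nonneg C M0)
  qed
  obtain y where y: "bij_betw y {..<n} A"
    using ex_bij_betw_nat_finite[OF A(1)] A(2) by (auto simp: atLeast0LessThan)
  have yA: "y i \<in> A" if "i < n" for i using y that by (auto simp: bij_betw_def)
  have "\<bar>integral {0..1} f - (\<Sum>i<n. (w (y i) / 2) * f ((y i + 1) / 2))\<bar> \<le> rule_const s * M / real n ^ s"
    if f: "deriv_bound s M 0 1 f" for M f
  proof -
    let ?f = "\<lambda>t. f (1/2 * t + 1/2)"
    have d: "deriv_bound s (M * (1/2) ^ s) (-1) 1 ?f"
      using f by (intro deriv_bound_affine) auto
    have "continuous_on {1/2 * (-1) + 1/2..1/2 * 1 + 1/2} f"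
      using deriv_bound_continuous[OF f] by simp
    from integral_affine[OF this]
    have I: "integral {0..1} f = 1/2 * integral {-1..1} ?f" by simp
    have "(\<Sum>i<n. (w (y i) / 2) * f ((y i + 1) / 2)) = (\<Sum>a\<in>A. (w a / 2) * f ((a + 1) / 2))"
      by (rule sum.reindex_bij_betw[OF y])
    also have "\<dots> = 1/2 * (\<Sum>a\<in>A. w a * ?f a)"
      by (simp add: sum_distrib_left add_divide_distrib)
    finally have Q: "(\<Sum>i<n. (w (y i) / 2) * f ((y i + 1) / 2)) = 1/2 * (\<Sum>a\<in>A. w a * ?f a)" .
    have "\<bar>integral {-1..1} ?f - (\<Sum>a\<in>A. w a * ?f a)\<bar> \<le> C * (M * (1/2) ^ s)"
      using A(3) by (intro quadrature_error_from_polys[OF A(1) _ w2 polys C d]) (auto intro: less_imp_le)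
    also have "C * (M * (1/2) ^ s) = 2 * (rule_const s * M / real n ^ s)"
      by (simp add: C_def power_one_over)
    finally show ?thesis unfolding I Q by simp
  qed
  moreover have "(y i + 1) / 2 \<in> {0..1} \<and> 0 \<le> w (y i) / 2" if "i < n" for i
    using A(3)[OF yA[OF that]] by auto
  ultimately show ?thesis
    unfolding has_rule_def
    by (intro exI[of _ "\<lambda>i. (y i + 1) / 2"] exI[of _ "\<lambda>i. w (y i) / 2"]) auto
qed

lemma midpoint_has_rule:
  assumes "s = 1 \<or> s = 2"
  shows "has_rule s (rule_const s) 1"
proof -
  have p: "pi / 2 \<ge> 31 / 20" using pi_approx(1) by simp
  have "sqrt 3 \<le> 1.8" by (rule real_le_lsqrt) (simp_all add: power2_eq_square)
  then have "6 * sqrt 3 \<le> 10.8" by simp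
  then have "(2.7::real) / 10.8 \<le> exp 1 / (6 * sqrt 3)"
    using exp_1_ge by (intro frac_le) auto
  then have q: "exp 1 / (6 * sqrt 3) \<ge> (1 / 4 :: real)" by simp
  have "1 / 4 \<le> 31 / 20 * (1 / 4 :: real)" by simp
  also have "\<dots> \<le> pi / 2 * (exp 1 / (6 * sqrt 3))"
    using p q by (intro mult_mono) auto
  finally have K1: "rule_const 1 \<ge> 1 / 4"
    unfolding rule_const_def power_one_right .
  have "1 / 12 \<le> 31 / 20 * (1 / 4 :: real)\<^sup>2" by (simp add: power2_eq_square)
  also have "\<dots> \<le> pi / 2 * (exp 1 / (6 * sqrt 3))\<^sup>2"
    using p q by (intro mult_mono power_mono) auto
  finally have K2: "rule_const 2 \<ge> 1 / 12"
    unfolding rule_const_def .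
  have "\<bar>integral {0..1} f - f (1/2)\<bar> \<le> rule_const s * M" if f: "deriv_bound s M 0 1 f" for f M
  proof -
    have M: "M \<ge> 0" using f by (force simp: deriv_bound_def)
    from assms show ?thesis
    proof
      assume s: "s = 1"
      show ?thesis
        using midpoint_error_first_order[of M f] f mult_right_mono[OF K1 M] by (simp add: s)
    next
      assume s: "s = 2"
      show ?thesis
        using midpoint_error_second_order[of M f] f mult_right_mono[OF K2 M] by (simp add: s)
    qed
  qed
  then show ?thesis
    unfolding has_rule_def by (intro exI[of _ "\<lambda>_. 1/2"] exI[of _ "\<lambda>_. 1"]) auto
qed

theorem has_rule_rule_const:
  assumes s: "s \<ge> 1" and n: "n \<ge> s + 1"
  shows "has_rule s (rule_const s) n"
proof (cases "s \<ge> 3")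
  case True
  show ?thesis
    by (rule has_rule_all_from_range[of "s + 1"]) (use True n in \<open>auto intro: Gauss_has_rule\<close>)
next
  case False
  then have "s = 1 \<or> s = 2" using s by auto
  note mid = midpoint_has_rule[OF this]
  show ?thesis
  proof (rule has_rule_all_from_range[of 1])
    fix k :: nat assume "1 \<le> k" "k < 2 * 1"
    then have "k = 1" by simp
    then show "has_rule s (rule_const s) k" using mid by (simp only:)
  qed (use n in auto)
qed

section \<open>Product rules on the cube\<close>

lemma deriv_bound_convex_combination:
  assumes h: "\<And>j. j < n \<Longrightarrow> deriv_bound s M a b (h j)" and w: "\<And>j. j < n \<Longrightarrow> 0 \<le> w j"
    and w1: "(\<Sum>j<n. w j) = 1"
  shows "deriv_bound s M a b (\<lambda>t. \<Sum>j<n. w j * h j t)"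
proof -
  have "\<forall>j\<in>{..<n}. \<exists>g. g 0 = h j \<and>
     (\<forall>k<s. \<forall>t\<in>{a..b}. (g k has_real_derivative g (Suc k) t) (at t within {a..b})) \<and>
     continuous_on {a..b} (g s) \<and> (\<forall>t\<in>{a..b}. \<bar>g s t\<bar> \<le> M)"
    using h unfolding deriv_bound_def by blast
  from bchoice[OF this] obtain g where "\<forall>j\<in>{..<n}. g j 0 = h j \<and>
     (\<forall>k<s. \<forall>t\<in>{a..b}. (g j k has_real_derivative g j (Suc k) t) (at t within {a..b})) \<and>
     continuous_on {a..b} (g j s) \<and> (\<forall>t\<in>{a..b}. \<bar>g j s t\<bar> \<le> M)"
    by blast
  then have g: "\<And>j. j < n \<Longrightarrow> g j 0 = h j"
    "\<And>j k t. j < n \<Longrightarrow> k < s \<Longrightarrow> t \<in> {a..b} \<Longrightarrow> (g j k has_real_derivative g j (Suc k) t) (at t within {a..b})"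
    "\<And>j. j < n \<Longrightarrow> continuous_on {a..b} (g j s)"
    "\<And>j t. j < n \<Longrightarrow> t \<in> {a..b} \<Longrightarrow> \<bar>g j s t\<bar> \<le> M"
    by auto
  have "\<bar>\<Sum>j<n. w j * g j s t\<bar> \<le> M" if "t \<in> {a..b}" for t
  proof -
    have "\<bar>\<Sum>j<n. w j * g j s t\<bar> \<le> (\<Sum>j<n. w j * M)"
      using w g(4) that by (intro order.trans[OF sum_abs] sum_mono) (auto simp: abs_mult intro!: mult_left_mono)
    also have "\<dots> = M" using w1 by (simp add: sum_distrib_right[symmetric])
    finally show ?thesis .
  qed
  then show ?thesis
    unfolding deriv_bound_def using g
    by (intro exI[of _ "\<lambda>k t. \<Sum>j<n. w j * g j k t"])
       (auto intro!: DERIV_sum DERIV_cmult continuous_intros)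
qed


definition upd :: "real ^ 'd::finite \<Rightarrow> 'd \<Rightarrow> real \<Rightarrow> real ^ 'd" where
  "upd x i t = (\<chi> j. if j = i then t else x $ j)"

lemma upd_nth [simp]: "upd x i t $ j = (if j = i then t else x $ j)"
  by (simp add: upd_def)

lemma upd_upd [simp]: "upd (upd x i t) i u = upd x i u"
  by (simp add: vec_eq_iff)

lemma upd_commute: "i \<noteq> j \<Longrightarrow> upd (upd x i t) j u = upd (upd x j u) i t"
  by (simp add: vec_eq_iff)

lemma upd_conv_axis: "upd x i t = x + (t - x $ i) *\<^sub>R axis i 1"
  by (simp add: vec_eq_iff axis_def)

lemma unit_cube_iff: "x \<in> unit_cube \<longleftrightarrow> (\<forall>i. x $ i \<in> {0..1})"
  by (simp add: mem_box_cart)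

lemma measure_unit_cube [simp]: "measure lborel (unit_cube :: (real ^ 'd::finite) set) = 1"
proof -
  have "(unit_cube :: (real ^ 'd) set) \<noteq> {}"
    using unit_cube_iff[of "0 :: real ^ 'd"] by force
  from content_cbox_cart[OF this] show ?thesis by simp
qed

lemma upd_in_unit_cube [simp]: "x \<in> unit_cube \<Longrightarrow> t \<in> {0..1} \<Longrightarrow> upd x i t \<in> unit_cube"
  by (simp add: unit_cube_iff)

lemma upd_in_unit_cube_iff:
  "x \<in> unit_cube \<Longrightarrow> upd x i t \<in> unit_cube \<longleftrightarrow> t \<in> {0..1}"
  by (auto simp: unit_cube_iff split: if_splits)

lemma continuous_on_upd [continuous_intros]:
  assumes "continuous_on S f" "continuous_on S g"
  shows "continuous_on S (\<lambda>z. upd (f z) i (g z))"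
  unfolding upd_conv_axis by (intro continuous_intros assms)

lemma count_list_single_support:
  assumes "\<And>j. count_list is j = (if j = i then k else 0)"
  shows "is = replicate k i"
  using assms
proof (induction "is" arbitrary: k)
  case Nil
  from Nil[of i] show ?case by simp
next
  case (Cons a xs)
  have a: "a = i" using Cons.prems[of a] by (auto split: if_splits)
  then obtain k' where k: "k = Suc k'" using Cons.prems[of i] by auto
  have "xs = replicate k' i"
  proof (rule Cons.IH)
    fix j show "count_list xs j = (if j = i then k' else 0)"
      using Cons.prems[of j] a k by (auto split: if_splits)
  qed
  then show ?case using a k by simp
qed

text \<open>
  For a multi-index supported in one coordinate only one list of directions has the prescribed counts, so
  the choice in \<open>Dmulti\<close> is determined.
\<close>
lemma Dmulti_pure:
  "Dmulti (\<chi> j. if j = i then k else 0) f = (partial i ^^ k) f"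
proof -
  let ?\<beta> = "\<chi> j. if j = i then k else (0::nat)"
  let ?is = "SOME is. \<forall>j. count_list is j = ?\<beta> $ j"
  have "\<forall>j. count_list (replicate k i) j = ?\<beta> $ j"
    by (induction k) auto
  then have "\<forall>j. count_list ?is j = ?\<beta> $ j" by (rule someI[where P = "\<lambda>is. \<forall>j. count_list is j = ?\<beta> $ j"])
  then have "?is = replicate k i"
    by (intro count_list_single_support) simp
  moreover have "foldr partial (replicate k i) f = (partial i ^^ k) f"
    by (induction k) auto
  ultimately show ?thesis by (simp add: Dmulti_def)
qed

lemma cont_diff_partial_power:
  "cont_diff (r + k) f \<Longrightarrow> cont_diff r ((partial i ^^ k) f)"
proof (induction k arbitrary: f)
  case (Suc k)
  then have "cont_diff (r + k) (partial i f)" by simp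
  from Suc.IH[OF this] show ?case by (simp add: funpow_Suc_right del: funpow.simps)
qed simp

lemma partial_has_derivative:
  assumes f: "has_partials f" and x: "x \<in> unit_cube" and t: "t \<in> {0..1}"
  shows "((\<lambda>t. f (upd x i t)) has_real_derivative partial i f (upd x i t)) (at t within {0..1})"
proof -
  let ?y = "upd x i t"
  let ?S = "{u. ?y + u *\<^sub>R axis i 1 \<in> unit_cube}"
  have y: "?y \<in> unit_cube" using x t by (rule upd_in_unit_cube)
  have eq: "?y + u *\<^sub>R axis i 1 = upd x i (t + u)" for u
    by (simp add: vec_eq_iff axis_def)
  have S: "(+) t ` ?S = {0..1}"
    unfolding eq upd_in_unit_cube_iff[OF x]
    by (auto simp: image_iff intro!: bexI[of _ "_ - t"] exI[of _ "_ - t"])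
  have "(\<lambda>u. f (?y + u *\<^sub>R axis i 1)) differentiable (at 0 within ?S)"
    using f y unfolding has_partials_def by blast
  then have "((\<lambda>u. f (?y + u *\<^sub>R axis i 1)) has_vector_derivative partial i f ?y) (at 0 within ?S)"
    unfolding partial_def vector_derivative_works .
  then have "((\<lambda>u. f (upd x i (t + u))) has_real_derivative partial i f ?y) (at 0 within ?S)"
    unfolding eq has_real_derivative_iff_has_vector_derivative .
  then show ?thesis
    using DERIV_at_within_shift[of "\<lambda>t. f (upd x i t)" "partial i f ?y" t 0 ?S] S by simp
qed

text \<open>
  All that the product construction uses about the class: the restrictions to lines parallel to the axes.
  Unlike the full class, this set is visibly closed under applying a rule in one coordinate.
\<close>
definition sections_bounded :: "nat \<Rightarrow> (real ^ 'd::finite \<Rightarrow> real) \<Rightarrow> bool" where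
  "sections_bounded s h \<longleftrightarrow> continuous_on unit_cube h \<and>
     (\<forall>i. \<forall>x\<in>unit_cube. deriv_bound s 1 0 1 (\<lambda>t. h (upd x i t)))"

lemma smooth_class_sections_bounded:
  fixes f :: "real ^ 'd::finite \<Rightarrow> real"
  assumes f: "f \<in> smooth_class r" and s: "s \<le> r"
  shows "sections_bounded s f"
proof -
  have cd: "cont_diff (r - k) ((partial i ^^ k) f)" if "k \<le> r" for k i
    using f that cont_diff_partial_power[of "r - k" k f i] by (simp add: smooth_class_def)
  have cont: "continuous_on unit_cube ((partial i ^^ k) f)" if "k \<le> r" for k i
    using cd[OF that, of i] by (cases "r - k") auto
  have hp: "has_partials ((partial i ^^ k) f)" if "k < r" for k i
  proof -
    have "cont_diff (Suc (r - Suc k)) ((partial i ^^ k) f)"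
      using cd[of k i] Suc_diff_Suc[OF that] that by simp
    then show ?thesis unfolding cont_diff.simps by blast
  qed
  have "deriv_bound s 1 0 1 (\<lambda>t. f (upd x i t))" if x: "x \<in> unit_cube" for x i
  proof -
    let ?g = "\<lambda>k t. (partial i ^^ k) f (upd x i t)"
    have "\<bar>?g s t\<bar> \<le> 1" if t: "t \<in> {0..1}" for t
    proof -
      let ?\<beta> = "(\<chi> j. if j = i then s else 0) :: nat ^ 'd"
      have "(\<Sum>j\<in>UNIV. ?\<beta> $ j) \<le> r" using s by simp
      then have "\<bar>Dmulti ?\<beta> f (upd x i t)\<bar> \<le> 1"
        using f upd_in_unit_cube[OF x t] unfolding smooth_class_def by blast
      then show ?thesis by (simp add: Dmulti_pure)
    qed
    moreover have "(?g k has_real_derivative ?g (Suc k) t) (at t within {0..1})"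
      if "k < s" "t \<in> {0..1}" for k t
      using partial_has_derivative[OF hp x that(2), of k i] that s by simp
    moreover have "continuous_on {0..1} (?g s)"
      using x by (intro continuous_on_compose2[OF cont[OF s]] continuous_intros) auto
    ultimately show ?thesis
      unfolding deriv_bound_def by (intro exI[of _ ?g]) auto
  qed
  then show ?thesis using cont[of 0] by (simp add: sections_bounded_def)
qed

lemma integral_unit_cube_lborel:
  assumes "continuous_on unit_cube h"
  shows "integrable lborel (\<lambda>x. indicator unit_cube x *\<^sub>R h x :: real)"
    "integral unit_cube h = (\<integral>x. indicator unit_cube x *\<^sub>R h x \<partial>lborel)"
proof -
  show 1: "integrable lborel (\<lambda>x. indicator unit_cube x *\<^sub>R h x)"
    by (rule borel_integrable_compact[OF compact_cbox assms])
  show "integral unit_cube h = (\<integral>x. indicator unit_cube x *\<^sub>R h x \<partial>lborel)"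
    using set_borel_integral_eq_integral(2)[of unit_cube h] 1
    unfolding set_integrable_def set_lebesgue_integral_def by simp
qed

text \<open>
  Lebesgue measure is the image of the product of the one-dimensional measures over the basis, and one
  factor of that product is split off.
\<close>
lemma lborel_integral_coordinate:
  fixes H :: "real ^ 'd::finite \<Rightarrow> real"
  assumes H: "integrable lborel H"
  shows "(\<integral>x. H x \<partial>lborel) =
    (\<integral>y. (\<integral>t. H (upd (\<Sum>b\<in>Basis - {axis i 1}. y b *\<^sub>R b) i t) \<partial>lborel) \<partial>(\<Pi>\<^sub>M b\<in>Basis - {axis i 1}. lborel))"
proof -
  interpret product_sigma_finite "\<lambda>b::real ^ 'd. lborel :: real measure" ..
  let ?b = "axis i 1 :: real ^ 'd"
  let ?B = "Basis - {?b}"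
  let ?S = "\<lambda>f::real ^ 'd \<Rightarrow> real. \<Sum>b\<in>Basis. f b *\<^sub>R b"
  have b: "?b \<in> Basis" by (simp add: axis_in_Basis_iff)
  have B: "insert ?b ?B = Basis" using b by auto
  have meas: "?S \<in> borel_measurable (\<Pi>\<^sub>M b\<in>Basis. lborel)" by measurable
  have Hm: "H \<in> borel_measurable borel" using H by simp
  have int: "integrable (\<Pi>\<^sub>M b\<in>insert ?b ?B. lborel) (\<lambda>f. H (?S f))"
    unfolding B using H integrable_distr_eq[OF meas Hm] lborel_eq[where 'a = "real ^ 'd"] by simp
  have S_upd: "?S (y(?b := t)) = upd (\<Sum>b\<in>?B. y b *\<^sub>R b) i t" for y t
  proof -
    have "?S (y(?b := t)) = t *\<^sub>R ?b + (\<Sum>b\<in>?B. (y(?b := t)) b *\<^sub>R b)"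
      using b by (subst sum.remove[of _ ?b]) auto
    also have "(\<Sum>b\<in>?B. (y(?b := t)) b *\<^sub>R b) = (\<Sum>b\<in>?B. y b *\<^sub>R b)"
      by (intro sum.cong) auto
    also have "t *\<^sub>R ?b + (\<Sum>b\<in>?B. y b *\<^sub>R b) = upd (\<Sum>b\<in>?B. y b *\<^sub>R b) i t"
    proof -
      have "(\<Sum>b\<in>?B. y b *\<^sub>R b) $ i = 0"
      proof -
        have "b $ i = 0" if "b \<in> ?B" for b
          using that by (auto simp: Basis_vec_def axis_def)
        then show ?thesis by (simp add: sum_component)
      qed
      then show ?thesis by (simp add: upd_conv_axis)
    qed
    finally show ?thesis .
  qed
  have "(\<integral>x. H x \<partial>lborel) = (\<integral>f. H (?S f) \<partial>(\<Pi>\<^sub>M b\<in>Basis. lborel))"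
    by (subst lborel_eq) (rule integral_distr[OF meas Hm])
  also have "\<dots> = (\<integral>f. H (?S f) \<partial>(\<Pi>\<^sub>M b\<in>insert ?b ?B. lborel))"
    unfolding B ..
  also have "\<dots> = (\<integral>y. (\<integral>t. H (?S (y(?b := t))) \<partial>lborel) \<partial>(\<Pi>\<^sub>M b\<in>?B. lborel))"
    by (rule product_integral_insert[OF _ _ int]) auto
  also have "(\<lambda>y. \<integral>t. H (?S (y(?b := t))) \<partial>lborel) =
      (\<lambda>y. \<integral>t. H (upd (\<Sum>b\<in>?B. y b *\<^sub>R b) i t) \<partial>lborel)"
    unfolding S_upd ..
  finally show ?thesis .
qed

lemma continuous_on_coordinate_integral:
  fixes h :: "real ^ 'd::finite \<Rightarrow> real"
  assumes "continuous_on unit_cube h"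
  shows "continuous_on unit_cube (\<lambda>x. integral {0..1} (\<lambda>t. h (upd x i t)))"
proof -
  have "continuous_on (unit_cube \<times> cbox 0 1) (\<lambda>(x, t). h (upd x i t))"
    unfolding case_prod_beta
    by (intro continuous_on_compose2[OF assms] continuous_intros) (auto simp: unit_cube_iff)
  from integral_continuous_on_param[OF this] show ?thesis by simp
qed

text \<open>
  After \<open>lborel_integral_coordinate\<close> both sides have the same inner integral: the function on the right is
  constant along the \<open>i\<close>-th direction, and the interval has length 1.
\<close>
lemma integral_unit_cube_coordinate:
  fixes h :: "real ^ 'd::finite \<Rightarrow> real"
  assumes h: "continuous_on unit_cube h"
  shows "integral unit_cube h = integral unit_cube (\<lambda>x. integral {0..1} (\<lambda>t. h (upd x i t)))"
proof -
  let ?K = "\<lambda>x. integral {0..1} (\<lambda>t. h (upd x i t))"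
  have K: "continuous_on unit_cube ?K" by (rule continuous_on_coordinate_integral[OF h])
  have same: "(\<integral>t. indicator unit_cube (upd y i t) *\<^sub>R h (upd y i t) \<partial>lborel) =
     (\<integral>t. indicator unit_cube (upd y i t) *\<^sub>R ?K (upd y i t) \<partial>lborel)" for y :: "real ^ 'd"
  proof (cases "upd y i 0 \<in> unit_cube")
    case True
    have ind: "indicator unit_cube (upd y i t) = (indicator {0..1} t :: real)" for t
      using upd_in_unit_cube_iff[OF True, of i t] by (simp add: indicator_def)
    have sub: "upd y i t \<in> unit_cube" if "t \<in> {0..1}" for t
      using upd_in_unit_cube[OF True that, of i] by simp
    have c: "continuous_on {0..1} (\<lambda>t. h (upd y i t))"
      by (rule continuous_on_compose2[OF h continuous_on_upd[OF continuous_on_const continuous_on_id]])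
         (use sub in blast)
    have "(\<integral>t. indicator {0..1} t *\<^sub>R h (upd y i t) \<partial>lborel) = ?K y"
      using set_borel_integral_eq_integral(2)[of "{0..1}" "\<lambda>t. h (upd y i t)"]
        borel_integrable_compact[OF compact_Icc c]
      unfolding set_integrable_def set_lebesgue_integral_def by simp
    moreover have "(\<integral>t. indicator {0..1} t *\<^sub>R ?K (upd y i t) \<partial>lborel) = ?K y"
      by simp
    ultimately show ?thesis unfolding ind by simp
  next
    case False
    then have "indicator unit_cube (upd y i t) = (0 :: real)" for t
      by (auto simp: indicator_def unit_cube_iff split: if_splits)
    then show ?thesis by simp
  qed
  have "integral unit_cube h = (\<integral>x. indicator unit_cube x *\<^sub>R h x \<partial>lborel)"
    by (rule integral_unit_cube_lborel(2)[OF h])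
  also have "\<dots> = (\<integral>x. indicator unit_cube x *\<^sub>R ?K x \<partial>lborel)"
    unfolding lborel_integral_coordinate[OF integral_unit_cube_lborel(1)[OF h], of i]
      lborel_integral_coordinate[OF integral_unit_cube_lborel(1)[OF K], of i] same ..
  also have "\<dots> = integral unit_cube ?K"
    by (rule integral_unit_cube_lborel(2)[OF K, symmetric])
  finally show ?thesis .
qed

text \<open>
  Replaces integration over the \<open>i\<close>-th coordinate by the rule. The result is again a function on the cube,
  constant in that coordinate, so that the product rule is an iteration over the coordinates.
\<close>
definition apply_rule :: "nat \<Rightarrow> (nat \<Rightarrow> real) \<Rightarrow> (nat \<Rightarrow> real) \<Rightarrow> 'd::finite \<Rightarrow>
    (real ^ 'd \<Rightarrow> real) \<Rightarrow> real ^ 'd \<Rightarrow> real" where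
  "apply_rule n x w i h = (\<lambda>p. \<Sum>j<n. w j * h (upd p i (x j)))"

lemma foldr_apply_rule_cong:
  assumes "\<And>k. k \<notin> set L \<Longrightarrow> p $ k = q $ k"
  shows "foldr (apply_rule n x w) L f p = foldr (apply_rule n x w) L f q"
  using assms
proof (induction L arbitrary: p q)
  case Nil
  then have "p = q" by (simp add: vec_eq_iff)
  then show ?case by simp
next
  case (Cons i L)
  then show ?case
    by (auto simp: apply_rule_def intro!: sum.cong Cons.IH)
qed

text \<open>
  The final map of an algorithm is arbitrary, so of the product rule only the finite set of points at
  which it reads the integrand has to be known.
\<close>
lemma foldr_apply_rule_nodes:
  fixes p :: "real ^ 'd::finite"
  assumes x: "\<And>j. j < n \<Longrightarrow> x j \<in> {0..1}" and p: "p \<in> unit_cube"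
  shows "\<exists>P. finite P \<and> P \<subseteq> unit_cube \<and> card P \<le> n ^ length L \<and>
    (\<forall>f g. (\<forall>q\<in>P. f q = g q) \<longrightarrow> foldr (apply_rule n x w) L f p = foldr (apply_rule n x w) L g p)"
  using p
proof (induction L arbitrary: p)
  case Nil
  then show ?case by (intro exI[of _ "{p}"]) auto
next
  case (Cons i L)
  have "\<forall>j\<in>{..<n}. \<exists>P. finite P \<and> P \<subseteq> unit_cube \<and> card P \<le> n ^ length L \<and>
    (\<forall>f g. (\<forall>q\<in>P. f q = g q) \<longrightarrow>
      foldr (apply_rule n x w) L f (upd p i (x j)) = foldr (apply_rule n x w) L g (upd p i (x j)))"
    using Cons.prems x by (intro ballI Cons.IH upd_in_unit_cube) auto
  from bchoice[OF this] obtain P where P: "\<And>j. j < n \<Longrightarrow> finite (P j)" "\<And>j. j < n \<Longrightarrow> P j \<subseteq> unit_cube"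
    "\<And>j. j < n \<Longrightarrow> card (P j) \<le> n ^ length L"
    "\<And>j f g. j < n \<Longrightarrow> (\<forall>q\<in>P j. f q = g q) \<Longrightarrow>
      foldr (apply_rule n x w) L f (upd p i (x j)) = foldr (apply_rule n x w) L g (upd p i (x j))"
    by (metis lessThan_iff)
  have "card (\<Union>j<n. P j) \<le> (\<Sum>j<n. card (P j))" by (rule card_UN_le) simp
  also have "\<dots> \<le> (\<Sum>j<n. n ^ length L)" by (intro sum_mono P) simp
  finally have "card (\<Union>j<n. P j) \<le> n ^ length (i # L)" by simp
  moreover have "foldr (apply_rule n x w) (i # L) f p = foldr (apply_rule n x w) (i # L) g p"
    if "\<forall>q\<in>(\<Union>j<n. P j). f q = g q" for f g
    using that P(4) by (auto simp: apply_rule_def intro!: sum.cong)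
  moreover have "finite (\<Union>j<n. P j)" "(\<Union>j<n. P j) \<subseteq> unit_cube" using P(1,2) by auto
  ultimately show ?case by (intro exI[of _ "\<Union>j<n. P j"]) blast
qed

context
  fixes s n :: nat and x w :: "nat \<Rightarrow> real" and e :: real
  assumes s: "s \<ge> 1"
    and xw: "\<And>j. j < n \<Longrightarrow> x j \<in> {0..1} \<and> 0 \<le> w j" and w1: "(\<Sum>j<n. w j) = 1"
    and err: "\<And>f. deriv_bound s 1 0 1 f \<Longrightarrow> \<bar>integral {0..1} f - (\<Sum>j<n. w j * f (x j))\<bar> \<le> e"
begin

text \<open>
  In the direction \<open>i\<close> the result is constant, and in the others it is a convex combination of sections of
  \<open>h\<close>. This is where nonnegative weights with sum 1 matter.
\<close>
lemma sections_bounded_apply_rule: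
  fixes h :: "real ^ 'd::finite \<Rightarrow> real"
  assumes h: "sections_bounded s h"
  shows "sections_bounded s (apply_rule n x w i h)"
  unfolding sections_bounded_def
proof (intro conjI allI ballI)
  have c: "continuous_on unit_cube h" using h by (simp add: sections_bounded_def)
  show "continuous_on unit_cube (apply_rule n x w i h)"
    unfolding apply_rule_def
    by (intro continuous_intros continuous_on_compose2[OF c])
       (auto intro!: upd_in_unit_cube simp: xw simp del: atLeastAtMost_iff)
  fix k :: 'd and p :: "real ^ 'd" assume p: "p \<in> unit_cube"
  show "deriv_bound s 1 0 1 (\<lambda>t. apply_rule n x w i h (upd p k t))"
  proof (cases "k = i")
    case True
    then have "(\<lambda>t. apply_rule n x w i h (upd p k t)) = (\<lambda>t. apply_rule n x w i h p)"
      by (simp add: apply_rule_def)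
    moreover have "deriv_bound s 0 0 1 (\<lambda>t. apply_rule n x w i h p)"
      by (rule deriv_bound_const_0[OF s])
    ultimately show ?thesis by (auto simp: deriv_bound_def)
  next
    case False
    then have "(\<lambda>t. apply_rule n x w i h (upd p k t)) = (\<lambda>t. \<Sum>j<n. w j * h (upd (upd p i (x j)) k t))"
      by (simp add: apply_rule_def upd_commute[of k i])
    moreover have "deriv_bound s 1 0 1 (\<lambda>t. h (upd (upd p i (x j)) k t))" if "j < n" for j
      using h p xw[OF that] by (auto simp: sections_bounded_def)
    ultimately show ?thesis
      using xw w1 by (auto intro!: deriv_bound_convex_combination)
  qed
qed

lemma integral_apply_rule_error:
  fixes h :: "real ^ 'd::finite \<Rightarrow> real"
  assumes h: "sections_bounded s h"
  shows "\<bar>integral unit_cube h - integral unit_cube (apply_rule n x w i h)\<bar> \<le> e"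
proof -
  have c: "continuous_on unit_cube h" using h by (simp add: sections_bounded_def)
  have c': "continuous_on unit_cube (apply_rule n x w i h)"
    using sections_bounded_apply_rule[OF h] by (simp add: sections_bounded_def)
  let ?K = "\<lambda>p. integral {0..1} (\<lambda>t. h (upd p i t))"
  have bd: "\<bar>?K p - apply_rule n x w i h p\<bar> \<le> e" if "p \<in> unit_cube" for p
    using err[of "\<lambda>t. h (upd p i t)"] h that by (simp add: sections_bounded_def apply_rule_def)
  have "((\<lambda>p. ?K p - apply_rule n x w i h p) has_integral
      (integral unit_cube ?K - integral unit_cube (apply_rule n x w i h))) unit_cube"
    by (intro has_integral_diff integrable_integral integrable_continuous c'
        continuous_on_coordinate_integral c)
  moreover have "0 \<le> e" using bd[of 0] by (simp add: unit_cube_iff)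
  ultimately have "norm (integral unit_cube ?K - integral unit_cube (apply_rule n x w i h)) \<le>
      e * measure lborel (unit_cube :: (real ^ 'd) set)"
    using bd by (intro has_integral_bound) auto
  then show ?thesis
    unfolding integral_unit_cube_coordinate[OF c, of i, symmetric] by simp
qed

lemma integral_foldr_apply_rule_error:
  fixes h :: "real ^ 'd::finite \<Rightarrow> real"
  assumes h: "sections_bounded s h"
  shows "sections_bounded s (foldr (apply_rule n x w) L h) \<and>
    \<bar>integral unit_cube h - integral unit_cube (foldr (apply_rule n x w) L h)\<bar> \<le> real (length L) * e"
proof (induction L)
  case Nil
  then show ?case using h by simp
next
  case (Cons i L)
  let ?g = "foldr (apply_rule n x w) L h"
  have g: "sections_bounded s ?g" using Cons by simp
  show ?case
    using sections_bounded_apply_rule[OF g] integral_apply_rule_error[OF g, of i] Cons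
    by (auto simp: algebra_simps)
qed

lemma cube_quadrature:
  "\<exists>P Q. finite P \<and> P \<subseteq> (unit_cube :: (real ^ 'd::finite) set) \<and> card P \<le> n ^ CARD('d) \<and>
    (\<forall>f g. (\<forall>q\<in>P. f q = g q) \<longrightarrow> Q f = Q g) \<and>
    (\<forall>f. sections_bounded s f \<longrightarrow> \<bar>integral unit_cube f - Q f\<bar> \<le> real CARD('d) * e)"
proof -
  obtain L :: "'d list" where L: "set L = UNIV" "distinct L"
    using finite_distinct_list[of "UNIV :: 'd set"] by auto
  then have len: "length L = CARD('d)" by (metis distinct_card)
  define Q where "Q = (\<lambda>f. foldr (apply_rule n x w) L f (0 :: real ^ 'd))"
  have "(0 :: real ^ 'd) \<in> unit_cube" by (simp add: unit_cube_iff)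
  from foldr_apply_rule_nodes[OF _ this, of n x L w] xw obtain P where P: "finite P"
    "P \<subseteq> (unit_cube :: (real ^ 'd) set)" "card P \<le> n ^ length L"
    "\<forall>f g. (\<forall>q\<in>P. f q = g q) \<longrightarrow> Q f = Q g"
    unfolding Q_def by auto
  have "\<bar>integral unit_cube f - Q f\<bar> \<le> real CARD('d) * e" if f: "sections_bounded s f" for f :: "real ^ 'd \<Rightarrow> real"
  proof -
    have "foldr (apply_rule n x w) L f = (\<lambda>p. Q f)"
      unfolding Q_def by (intro ext foldr_apply_rule_cong) (simp add: L)
    moreover have "integral (unit_cube :: (real ^ 'd) set) (\<lambda>p. Q f) = Q f"
      by simp
    ultimately show ?thesis
      using integral_foldr_apply_rule_error[OF f, of L] len by simp
  qed
  with P len show ?thesis by (intro exI[of _ P] exI[of _ Q]) auto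
qed

end

section \<open>Algorithms and complexity\<close>

lemma samples_nonadaptive:
  "samples (\<lambda>ys. \<nu> (length ys)) n f = map (\<lambda>k. f (\<nu> k)) [0..<n]"
  by (induction n) auto

text \<open>
  A functional that depends on the values at finitely many points is a nonadaptive algorithm: sample all the
  points, then evaluate the functional at some function with these samples. If \<open>P\<close> has fewer than \<open>N\<close>
  points, the remaining samples are taken at the corner \<open>0\<close>.
\<close>
lemma minimal_error_le:
  fixes Q :: "(real ^ 'd::finite \<Rightarrow> real) \<Rightarrow> real"
  assumes P: "finite P" "P \<subseteq> unit_cube" "card P \<le> N"
    and dep: "\<And>f g. (\<forall>q\<in>P. f q = g q) \<Longrightarrow> Q f = Q g"
    and err: "\<And>f. f \<in> smooth_class r \<Longrightarrow> \<bar>integral unit_cube f - Q f\<bar> \<le> \<epsilon>"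
  shows "minimal_error TYPE('d) r N \<le> ennreal \<epsilon>"
proof -
  obtain ps where ps: "set ps = P" "distinct ps" using finite_distinct_list[OF P(1)] by blast
  then have len: "length ps \<le> N" using P(3) by (metis distinct_card)
  define \<nu> where "\<nu> = (\<lambda>k. if k < length ps then ps ! k else 0)"
  have cube: "\<nu> k \<in> unit_cube" for k
  proof (cases "k < length ps")
    case True
    then have "ps ! k \<in> P" using ps(1) nth_mem by blast
    then show ?thesis using True P(2) by (auto simp: \<nu>_def)
  next
    case False
    then show ?thesis by (simp add: \<nu>_def unit_cube_iff)
  qed
  let ?s = "samples (\<lambda>ys. \<nu> (length ys)) N"
  define \<phi> where "\<phi> = (\<lambda>ys. Q (SOME g. ?s g = ys))"
  have Q: "\<phi> (?s f) = Q f" for f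
    unfolding \<phi>_def
  proof (rule dep, rule ballI)
    fix q assume "q \<in> P"
    then obtain k where k: "k < length ps" "q = ps ! k" using ps(1) by (metis in_set_conv_nth)
    have "?s (SOME g. ?s g = ?s f) = ?s f" by (rule someI[of "\<lambda>g. ?s g = ?s f" f]) simp
    then have "(SOME g. ?s g = ?s f) (\<nu> k) = f (\<nu> k)"
      unfolding samples_nonadaptive using k(1) len by simp
    then show "(SOME g. ?s g = ?s f) q = f q" using k by (simp add: \<nu>_def)
  qed
  have "(\<lambda>f. \<phi> (?s f)) \<in> algorithms N"
    unfolding algorithms_def
    by (intro CollectI exI[of _ "\<lambda>ys. \<nu> (length ys)"] exI[of _ \<phi>] conjI allI impI cube refl)
  moreover have "worst_case_error r (\<lambda>f. \<phi> (?s f)) \<le> ennreal \<epsilon>"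
    unfolding worst_case_error_def Q by (intro SUP_least ennreal_leI err)
  ultimately show ?thesis
    unfolding minimal_error_def by (rule INF_lower2[of "\<lambda>f. \<phi> (?s f)"])
qed

lemma complexity_le_of_rule:
  fixes d :: nat
  assumes d: "d = CARD('d::finite)" and s: "1 \<le> s" "s \<le> r" and rule: "has_rule s K m"
    and m: "m \<ge> 1" "real d * K \<le> \<epsilon> * real m ^ s"
  shows "complexity \<epsilon> TYPE('d) r \<le> enat (m ^ d)"
proof -
  obtain x w where xw: "\<And>j. j < m \<Longrightarrow> x j \<in> {0..1} \<and> 0 \<le> w j"
    and err: "\<And>M f. deriv_bound s M 0 1 f \<Longrightarrow>
        \<bar>integral {0..1} f - (\<Sum>j<m. w j * f (x j))\<bar> \<le> K * M / real m ^ s"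
    using rule unfolding has_rule_def by blast
  have w1: "(\<Sum>j<m. w j) = 1"
    using err[OF deriv_bound_const_0[OF s(1), of 0 1 1]] by simp
  have err1: "\<bar>integral {0..1} f - (\<Sum>j<m. w j * f (x j))\<bar> \<le> K / real m ^ s"
    if "deriv_bound s 1 0 1 f" for f
    using err[OF that] by simp
  obtain P and Q :: "(real ^ 'd \<Rightarrow> real) \<Rightarrow> real" where P: "finite P" "P \<subseteq> unit_cube" "card P \<le> m ^ CARD('d)"
    and dep: "\<forall>f g. (\<forall>q\<in>P. f q = g q) \<longrightarrow> Q f = Q g"
    and Q: "\<forall>f. sections_bounded s f \<longrightarrow> \<bar>integral unit_cube f - Q f\<bar> \<le> real CARD('d) * (K / real m ^ s)"
    using cube_quadrature[OF s(1) xw w1 err1] by blast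
  have e: "real CARD('d) * (K / real m ^ s) \<le> \<epsilon>"
    using m by (simp add: d divide_le_eq)
  have "minimal_error TYPE('d) r (m ^ d) \<le> ennreal \<epsilon>"
    unfolding d
  proof (rule minimal_error_le[OF P])
    show "Q f = Q g" if "\<forall>q\<in>P. f q = g q" for f g
      using dep that by blast
    show "\<bar>integral unit_cube f - Q f\<bar> \<le> \<epsilon>" if "f \<in> smooth_class r" for f
      using Q smooth_class_sections_bounded[OF that s(2)] e by force
  qed
  then show ?thesis
    unfolding complexity_def by (intro Inf_lower imageI) simp
qed

theorem theorem4:
  fixes r :: nat and \<epsilon> :: real
  assumes "r \<ge> 1" and "0 < \<epsilon>" and "\<epsilon> < 1"
  shows "complexity \<epsilon> TYPE('d::finite) r \<le> enat (MIN s\<in>{1..r}.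
    max ((s + 1) ^ CARD('d))
        (nat \<lceil>(pi / 2 * (exp 1 / (6 * sqrt 3)) ^ s * (real CARD('d) / \<epsilon>)) powr (1 / real s)\<rceil>
           ^ CARD('d)))"
proof -
  let ?y = "\<lambda>s. rule_const s * (real CARD('d) / \<epsilon>)"
  let ?c = "\<lambda>s. nat \<lceil>?y s powr (1 / real s)\<rceil>"
  let ?B = "\<lambda>s. max ((s + 1) ^ CARD('d)) (?c s ^ CARD('d))"
  have "complexity \<epsilon> TYPE('d) r \<le> enat (?B s)" if s: "s \<in> {1..r}" for s
  proof -
    define m where "m = max (s + 1) (?c s)"
    have y: "?y s > 0" using rule_const_pos[of s] assms(2) by simp
    have "z = (z powr (1 / real s)) powr real s" if "z > 0" for z
      using that s by (simp add: powr_powr)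
    from this[OF y] have "?y s = (?y s powr (1 / real s)) powr real s" .
    also have "\<dots> \<le> real m powr real s"
    proof (rule powr_mono2)
      show "?y s powr (1 / real s) \<le> real m"
        unfolding m_def by (rule order.trans[OF real_nat_ceiling_ge]) simp
    qed auto
    also have "\<dots> = real m ^ s"
      by (rule powr_realpow) (simp add: m_def)
    finally have "real CARD('d) * rule_const s \<le> \<epsilon> * real m ^ s"
      using assms(2) by (simp add: field_simps)
    moreover have "has_rule s (rule_const s) m"
      using s by (intro has_rule_rule_const) (auto simp: m_def)
    ultimately have "complexity \<epsilon> TYPE('d) r \<le> enat (m ^ CARD('d))"
      using s by (intro complexity_le_of_rule[OF refl]) (auto simp: m_def)
    also have "m ^ CARD('d) = ?B s"
      unfolding m_def by (simp add: max_def power_mono le_antisym)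
    finally show ?thesis .
  qed
  moreover have "(MIN s\<in>{1..r}. ?B s) \<in> ?B ` {1..r}"
    using assms(1) by (intro Min_in) auto
  ultimately have "complexity \<epsilon> TYPE('d) r \<le> enat (MIN s\<in>{1..r}. ?B s)" by auto
  then show ?thesis unfolding rule_const_def .
qed

end
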